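(* Let $k\in\mathbb{N}$ and for $i\in[k]$ let $G_i$ and $H_i$ be connected graphs with $\bigl||G_i|-|H_i|\bigr|\le2$. Then $$q\Bigl(\bigcup_{i=1}^kG_i\vee\bigcup_{i=1}^kH_i\Bigr)=2.$$ Moreover, if $m_1,\dots,m_k\in\mathbb{N}$ and $H_1,\dots,H_k$ are connected graphs with $m_i+2\ge|H_i|$ for all $i\in[k]$, then $$q\Bigl(\bigcup_{i=1}^kK_{m_i}\vee\bigcup_{i=1}^kH_i\Bigr)=2.$$
   Context: $S(G)$ is the set of real symmetric matrices indexed by $V(G)$ whose $(i,j)$ off-diagonal entry is nonzero iff $\{i,j\}\in E(G)$ (diagonal unrestricted); $q(G)=\min\{q(A):A\in S(G)\}$ with $q(A)$ the number of distinct eigenvalues of $A$. $\bigcup$ denotes disjoint union of graphs, $\vee$ the join (disjoint union plus all edges between the two vertex sets), $K_m$ the complete graph on $m$ vertices, and $|G|$ the number of vertices. *)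

theory Defs
  imports Complex_Main
begin

type_synonym 'a graph = "'a set \<times> ('a \<Rightarrow> 'a \<Rightarrow> bool)"

definition verts :: "'a graph \<Rightarrow> 'a set" where "verts G = fst G"
definition adj :: "'a graph \<Rightarrow> 'a \<Rightarrow> 'a \<Rightarrow> bool" where "adj G = snd G"

definition simple_graph :: "'a graph \<Rightarrow> bool" where
  "simple_graph G \<longleftrightarrow> finite (verts G)
     \<and> (\<forall>u v. adj G u v \<longrightarrow> u \<in> verts G \<and> v \<in> verts G)
     \<and> (\<forall>u v. adj G u v \<longrightarrow> adj G v u)
     \<and> (\<forall>u. \<not> adj G u u)"

definition connected_graph :: "'a graph \<Rightarrow> bool" where
  "connected_graph G \<longleftrightarrow> simple_graph G \<and> verts G \<noteq> {}
     \<and> (\<forall>u\<in>verts G. \<forall>v\<in>verts G. (adj G)\<^sup>*\<^sup>* u v)"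

definition dunion :: "nat \<Rightarrow> (nat \<Rightarrow> 'a graph) \<Rightarrow> (nat \<times> 'a) graph" where
  "dunion k G = ({(i, v). i < k \<and> v \<in> verts (G i)},
                 \<lambda>(i, u) (j, w). i = j \<and> i < k \<and> adj (G i) u w)"

definition join :: "'a graph \<Rightarrow> 'b graph \<Rightarrow> ('a + 'b) graph" where
  "join G H = (Inl ` verts G \<union> Inr ` verts H,
     \<lambda>x y. case (x, y) of
        (Inl a, Inl b) \<Rightarrow> adj G a b
      | (Inr a, Inr b) \<Rightarrow> adj H a b
      | (Inl a, Inr b) \<Rightarrow> a \<in> verts G \<and> b \<in> verts H
      | (Inr a, Inl b) \<Rightarrow> a \<in> verts H \<and> b \<in> verts G)"

definition complete_graph :: "nat \<Rightarrow> nat graph" where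
  "complete_graph m = ({..<m}, \<lambda>i j. i \<noteq> j \<and> i < m \<and> j < m)"

definition S_graph :: "'a graph \<Rightarrow> ('a \<Rightarrow> 'a \<Rightarrow> real) set" where
  "S_graph G = {A. (\<forall>i j. (i \<notin> verts G \<or> j \<notin> verts G) \<longrightarrow> A i j = 0)
     \<and> (\<forall>i j. A i j = A j i)
     \<and> (\<forall>i\<in>verts G. \<forall>j\<in>verts G. i \<noteq> j \<longrightarrow> (A i j \<noteq> 0 \<longleftrightarrow> adj G i j))}"

definition is_eigenvalue :: "'a set \<Rightarrow> ('a \<Rightarrow> 'a \<Rightarrow> real) \<Rightarrow> real \<Rightarrow> bool" where
  "is_eigenvalue V A mu \<longleftrightarrow> (\<exists>x :: 'a \<Rightarrow> real. (\<exists>j\<in>V. x j \<noteq> 0)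
       \<and> (\<forall>i\<in>V. (\<Sum>j\<in>V. A i j * x j) = mu * x i))"

definition q_mat :: "'a set \<Rightarrow> ('a \<Rightarrow> 'a \<Rightarrow> real) \<Rightarrow> nat" where
  "q_mat V A = card {mu. is_eigenvalue V A mu}"

definition q_graph :: "'a graph \<Rightarrow> nat" where
  "q_graph G = (LEAST n. \<exists>A\<in>S_graph G. q_mat (verts G) A = n)"

end

(*
  It suffices to find a nonscalar symmetric M with M^2 = 1 and the right zero pattern. Write
  M = [[A, B], [B^T, C]] with A the direct sum of matrices A_i for G_i and C of matrices C_i for H_i.
  Give A_i distinct eigenvalues in [0,1), one of them 0, plus possibly 1 and -1, and give C_i the negatives of
  those in [0,1) (or the other way round). With orthonormal eigenvectors u_l of A_i and v_l of C_i, the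
  diagonal block B_ii is the sum of sqrt(1 - lam_l^2) u_l v_l^T, where the kernel term u_0 v_0^T is rescaled by W_ii,
  and B_ij = W_ij u_0 v_0^T off the diagonal, for an orthogonal k x k matrix W without zeros. All of this is
  nowhere zero once the eigenvectors are nowhere zero and those of C_i are close to unit vectors.

  Such eigenvectors come from A = diag(d) + eps E, where E weights the edges of a spanning tree by 1
  and all other edges by eps^n; a contraction determines d so that the spectrum is the prescribed one.

  For complete graphs, replacing a vertex by two copies of weight 1/sqrt 2 adds an eigenvalue 1.

  The lower bound 2 holds because the largest and the smallest Rayleigh quotient of a nonscalar symmetric
  matrix are distinct eigenvalues.
*)
theory Submission
  imports Defs "HOL-Analysis.Function_Topology"
begin

section \<open>Eigenvalues of symmetric matrices\<close>

text \<open>The condition AB + BC = 0 lets B map the eigenspace of C for -lam only into that of A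
  for lam, and B B^T = 1 - A^2 is invertible there unless lam is 1 or -1. All other eigenvalues must
  therefore match exactly, so spectra have to be prescribed and not merely approximated. The
  realized spectra are simple, so 1 and -1 are available once each to the larger graph: this is the
  slack 2. A complete graph may repeat the eigenvalue 1, which removes the bound on its size.

  B must be nonzero between any two components although A and C are block diagonal. Hence all
  components need a common eigenvalue through which they are coupled, and 0 serves. On the kernels,
  spanned by one vector per component, any orthogonal matrix W may be used.

  The rescaling by W_ii changes the diagonal blocks, so their zero pattern can be judged only once
  W_ii is known. This orders the choices: W, then nowhere zero eigenvectors for one graph, and last
  those for the other, so near to unit vectors that a single term dominates each entry of the
  block.\<close>

lemma parseval:
  fixes U :: "'i \<Rightarrow> 'a \<Rightarrow> real"
  assumes I: "finite I"
    and U: "\<And>l l'. l \<in> I \<Longrightarrow> l' \<in> I \<Longrightarrow> (\<Sum>x\<in>V. U l x * U l' x) = (if l = l' then 1 else 0)"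
  shows "(\<Sum>x\<in>V. (\<Sum>l\<in>I. p l * U l x) * (\<Sum>l\<in>I. q l * U l x)) = (\<Sum>l\<in>I. p l * q l)"
proof -
  have "(\<Sum>x\<in>V. (\<Sum>l\<in>I. p l * U l x) * (\<Sum>l\<in>I. q l * U l x))
      = (\<Sum>x\<in>V. \<Sum>l\<in>I. \<Sum>l'\<in>I. p l * q l' * (U l x * U l' x))"
    by (simp add: sum_product mult_ac)
  also have "\<dots> = (\<Sum>l\<in>I. \<Sum>l'\<in>I. p l * q l' * (\<Sum>x\<in>V. U l x * U l' x))"
    by (subst sum.swap, rule sum.cong[OF refl], subst sum.swap) (simp add: sum_distrib_left)
  also have "\<dots> = (\<Sum>l\<in>I. \<Sum>l'\<in>I. if l = l' then p l * q l' else 0)"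
    by (intro sum.cong refl) (simp add: U)
  also have "\<dots> = (\<Sum>l\<in>I. p l * q l)"
    using I by simp
  finally show ?thesis .
qed

text \<open>The inner sum is the orthogonal projection of the unit vector at \<open>a\<close> onto
  the span of the \<open>U l\<close>; the left side is the squared distance between the two.\<close>

lemma bessel_residual:
  fixes U :: "'i \<Rightarrow> 'a \<Rightarrow> real"
  assumes V: "finite V" and I: "finite I" and a: "a \<in> V"
    and U: "\<And>l l'. l \<in> I \<Longrightarrow> l' \<in> I \<Longrightarrow> (\<Sum>x\<in>V. U l x * U l' x) = (if l = l' then 1 else 0)"
  shows "(\<Sum>x\<in>V. ((if a = x then 1 else 0) - (\<Sum>l\<in>I. U l a * U l x))\<^sup>2) = 1 - (\<Sum>l\<in>I. (U l a)\<^sup>2)"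
proof -
  let ?s = "\<lambda>x. \<Sum>l\<in>I. U l a * U l x"
  have "(\<Sum>x\<in>V. ((if a = x then 1 else 0) - ?s x)\<^sup>2)
      = (\<Sum>x\<in>V. (if a = x then 1 - 2 * ?s x else 0) + ?s x * ?s x)"
    by (intro sum.cong refl) (simp add: power2_eq_square algebra_simps)
  also have "\<dots> = 1 - 2 * ?s a + (\<Sum>x\<in>V. ?s x * ?s x)"
    using V a by (simp add: sum.distrib)
  also have "(\<Sum>x\<in>V. ?s x * ?s x) = (\<Sum>l\<in>I. U l a * U l a)"
    by (rule parseval[OF I U])
  finally show ?thesis by (simp add: power2_eq_square)
qed

lemma bessel:
  fixes U :: "'i \<Rightarrow> 'a \<Rightarrow> real"
  assumes "finite V" "finite I" "a \<in> V"
    and "\<And>l l'. l \<in> I \<Longrightarrow> l' \<in> I \<Longrightarrow> (\<Sum>x\<in>V. U l x * U l' x) = (if l = l' then 1 else 0)"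
  shows "(\<Sum>l\<in>I. (U l a)\<^sup>2) \<le> 1"
  using bessel_residual[OF assms] sum_nonneg[of V "\<lambda>x. ((if a = x then 1 else 0) - (\<Sum>l\<in>I. U l a * U l x))\<^sup>2"]
  by simp

lemma sum_squares_orthonormal:
  fixes U :: "'i \<Rightarrow> 'a \<Rightarrow> real"
  assumes "\<And>l l'. l \<in> I \<Longrightarrow> l' \<in> I \<Longrightarrow> (\<Sum>x\<in>V. U l x * U l' x) = (if l = l' then 1 else 0)"
  shows "(\<Sum>a\<in>V. \<Sum>l\<in>I. (U l a)\<^sup>2) = real (card I)"
  by (subst sum.swap) (simp add: power2_eq_square assms)

text \<open>Double counting replaces a dimension argument: the squares of all entries add up to 1
  for each \<open>l \<in> I\<close>, and by Bessel to at most 1 for each point of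
  \<open>V\<close>.\<close>

lemma card_orthonormal_le:
  fixes U :: "'i \<Rightarrow> 'a \<Rightarrow> real"
  assumes V: "finite V" and I: "finite I"
    and U: "\<And>l l'. l \<in> I \<Longrightarrow> l' \<in> I \<Longrightarrow> (\<Sum>x\<in>V. U l x * U l' x) = (if l = l' then 1 else 0)"
  shows "card I \<le> card V"
proof -
  have "(\<Sum>a\<in>V. \<Sum>l\<in>I. (U l a)\<^sup>2) \<le> (\<Sum>a\<in>V. 1)"
    by (intro sum_mono bessel[OF V I _ U])
  thus ?thesis using sum_squares_orthonormal[OF U] by simp
qed

text \<open>In the double count, equal cardinalities force equality in every Bessel inequality. Each
  unit vector then coincides with its projection; in matrix terms, orthonormal rows of a square
  matrix give orthonormal columns.\<close>

lemma orthonormal_complete: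
  fixes U :: "'i \<Rightarrow> 'a \<Rightarrow> real"
  assumes V: "finite V" and I: "finite I" and c: "card I = card V"
    and U: "\<And>l l'. l \<in> I \<Longrightarrow> l' \<in> I \<Longrightarrow> (\<Sum>x\<in>V. U l x * U l' x) = (if l = l' then 1 else 0)"
    and a: "a \<in> V" and b: "b \<in> V"
  shows "(\<Sum>l\<in>I. U l a * U l b) = (if a = b then 1 else 0)"
proof -
  have "(\<Sum>a\<in>V. 1 - (\<Sum>l\<in>I. (U l a)\<^sup>2)) = 0"
    using sum_squares_orthonormal[OF U] c by (simp add: sum_subtractf)
  moreover have "\<And>a. a \<in> V \<Longrightarrow> 0 \<le> 1 - (\<Sum>l\<in>I. (U l a)\<^sup>2)"
    using bessel[OF V I _ U] by simp
  ultimately have "1 - (\<Sum>l\<in>I. (U l a)\<^sup>2) = 0"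
    using a sum_nonneg_eq_0_iff[OF V] by (metis (no_types, lifting))
  hence "(\<Sum>x\<in>V. ((if a = x then 1 else 0) - (\<Sum>l\<in>I. U l a * U l x))\<^sup>2) = 0"
    using bessel_residual[OF V I a U] by simp
  hence "((if a = b then 1 else 0) - (\<Sum>l\<in>I. U l a * U l b))\<^sup>2 = 0"
    using b sum_nonneg_eq_0_iff[OF V] by (metis (no_types, lifting) zero_le_power2)
  thus ?thesis by simp
qed

section \<open>Spectra of symmetric matrices: extreme Rayleigh quotients and involutions\<close>

lemma symmetric_bilinear:
  fixes A :: "'a \<Rightarrow> 'a \<Rightarrow> real"
  assumes "\<And>i j. i \<in> V \<Longrightarrow> j \<in> V \<Longrightarrow> A i j = A j i"
  shows "(\<Sum>i\<in>V. (\<Sum>j\<in>V. A i j * x j) * y i) = (\<Sum>i\<in>V. (\<Sum>j\<in>V. A i j * y j) * x i)"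
  unfolding sum_distrib_right
  by (subst sum.swap) (intro sum.cong refl, simp add: assms mult_ac)

lemma eigenvectors_orthogonal:
  fixes A :: "'a \<Rightarrow> 'a \<Rightarrow> real"
  assumes sym: "\<And>i j. i \<in> V \<Longrightarrow> j \<in> V \<Longrightarrow> A i j = A j i"
    and x: "\<And>i. i \<in> V \<Longrightarrow> (\<Sum>j\<in>V. A i j * x j) = mu * x i"
    and y: "\<And>i. i \<in> V \<Longrightarrow> (\<Sum>j\<in>V. A i j * y j) = nu * y i"
    and ne: "mu \<noteq> nu"
  shows "(\<Sum>i\<in>V. x i * y i) = 0"
proof -
  have "mu * (\<Sum>i\<in>V. x i * y i) = (\<Sum>i\<in>V. (\<Sum>j\<in>V. A i j * x j) * y i)"
    unfolding sum_distrib_left by (intro sum.cong refl) (simp add: x)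
  also have "\<dots> = (\<Sum>i\<in>V. (\<Sum>j\<in>V. A i j * y j) * x i)"
    by (rule symmetric_bilinear[OF sym])
  also have "\<dots> = nu * (\<Sum>i\<in>V. x i * y i)"
    unfolding sum_distrib_left by (intro sum.cong refl) (simp add: y)
  finally show ?thesis using ne by simp
qed

text \<open>Normalized eigenvectors for distinct eigenvalues are orthonormal, so there are at most
  \<open>card V\<close> of them. Finiteness matters because \<open>card\<close> of an infinite set
  is 0, which would falsify lower bounds on \<open>q_mat\<close>.\<close>

lemma finite_eigenvalues:
  fixes A :: "'a \<Rightarrow> 'a \<Rightarrow> real"
  assumes V: "finite V" and sym: "\<And>i j. i \<in> V \<Longrightarrow> j \<in> V \<Longrightarrow> A i j = A j i"
  shows "finite {mu. is_eigenvalue V A mu}"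
proof (rule ccontr)
  assume "infinite {mu. is_eigenvalue V A mu}"
  then obtain F where F: "finite F" "card F = Suc (card V)" "F \<subseteq> {mu. is_eigenvalue V A mu}"
    using infinite_arbitrarily_large by blast
  have "\<forall>mu\<in>F. \<exists>x. (\<exists>j\<in>V. x j \<noteq> 0) \<and> (\<forall>i\<in>V. (\<Sum>j\<in>V. A i j * x j) = mu * x i)"
    using F(3) unfolding is_eigenvalue_def by blast
  then obtain x where x: "\<And>mu. mu \<in> F \<Longrightarrow> \<exists>j\<in>V. x mu j \<noteq> 0"
      "\<And>mu i. mu \<in> F \<Longrightarrow> i \<in> V \<Longrightarrow> (\<Sum>j\<in>V. A i j * x mu j) = mu * x mu i"
    by metis
  define N where "N mu = (\<Sum>j\<in>V. (x mu j)\<^sup>2)" for mu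
  have N: "N mu > 0" if "mu \<in> F" for mu
  proof -
    obtain j where "j \<in> V" "x mu j \<noteq> 0" using x(1) \<open>mu \<in> F\<close> by blast
    thus ?thesis unfolding N_def by (intro sum_pos2[OF V]) auto
  qed
  define U where "U mu j = x mu j / sqrt (N mu)" for mu j
  have "(\<Sum>j\<in>V. U mu j * U nu j) = (if mu = nu then 1 else 0)" if "mu \<in> F" "nu \<in> F" for mu nu
  proof -
    have "(\<Sum>j\<in>V. U mu j * U nu j) = (\<Sum>j\<in>V. x mu j * x nu j) / (sqrt (N mu) * sqrt (N nu))"
      by (simp add: U_def sum_divide_distrib)
    moreover have "(\<Sum>j\<in>V. x mu j * x nu j) = (if mu = nu then N mu else 0)"
      using eigenvectors_orthogonal[OF sym x(2)[OF that(1)] x(2)[OF that(2)]]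
      by (simp add: N_def power2_eq_square)
    ultimately show ?thesis using N[OF that(1)] N[OF that(2)] by simp
  qed
  hence "card F \<le> card V" by (rule card_orthonormal_le[OF V F(1)])
  thus False using F(2) by simp
qed

text \<open>Vanishing off \<open>V\<close> puts the sphere into a product of intervals and
  singletons, which is compact by Tychonoff even if the index type is infinite.\<close>

lemma compact_sphere_fun:
  assumes V: "finite V"
  shows "compact {x :: 'a \<Rightarrow> real. (\<forall>j. j \<notin> V \<longrightarrow> x j = 0) \<and> (\<Sum>j\<in>V. (x j)\<^sup>2) = 1}" (is "compact ?S")
proof -
  let ?B = "PiE UNIV (\<lambda>j. if j \<in> V then {-1..1::real} else {0})"
  have "compactin (product_topology (\<lambda>_. euclidean) UNIV) ?B"
    by (subst compactin_PiE) auto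
  hence B: "compact ?B" by (simp add: euclidean_product_topology)
  have cont: "continuous_on UNIV (\<lambda>x :: 'a \<Rightarrow> real. \<Sum>j\<in>V. (x j)\<^sup>2)"
    by (intro continuous_intros continuous_on_product_coordinates)
  have "closed {x :: 'a \<Rightarrow> real. (\<Sum>j\<in>V. (x j)\<^sup>2) = 1}"
    by (rule closed_Collect_eq[OF cont]) auto
  hence "compact (?B \<inter> {x. (\<Sum>j\<in>V. (x j)\<^sup>2) = 1})" by (rule compact_Int_closed[OF B])
  moreover have "?B \<inter> {x. (\<Sum>j\<in>V. (x j)\<^sup>2) = 1} = ?S"
  proof -
    have "x j \<in> {-1..1}" if "j \<in> V" "(\<Sum>j\<in>V. (x j)\<^sup>2) = 1" for x :: "'a \<Rightarrow> real" and j
    proof -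
      have "(x j)\<^sup>2 \<le> 1" using member_le_sum[OF that(1), of "\<lambda>j. (x j)\<^sup>2"] V that(2) by simp
      thus ?thesis by (auto simp: abs_square_le_1 abs_le_iff)
    qed
    thus ?thesis by (fastforce simp: PiE_iff split: if_splits)
  qed
  ultimately show ?thesis by simp
qed

lemma rayleigh_max:
  fixes A :: "'a \<Rightarrow> 'a \<Rightarrow> real"
  assumes V: "finite V" "V \<noteq> {}" and sym: "\<And>i j. i \<in> V \<Longrightarrow> j \<in> V \<Longrightarrow> A i j = A j i"
  shows "\<exists>mu. is_eigenvalue V A mu
           \<and> (\<forall>y. (\<Sum>i\<in>V. (\<Sum>j\<in>V. A i j * y j) * y i) \<le> mu * (\<Sum>i\<in>V. (y i)\<^sup>2))"
proof -
  define Q where "Q y = (\<Sum>i\<in>V. (\<Sum>j\<in>V. A i j * y j) * y i)" for y :: "'a \<Rightarrow> real"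
  let ?S = "{x :: 'a \<Rightarrow> real. (\<forall>j. j \<notin> V \<longrightarrow> x j = 0) \<and> (\<Sum>j\<in>V. (x j)\<^sup>2) = 1}"
  obtain p where p: "p \<in> V" using V by blast
  have "(\<Sum>j\<in>V. (if j = p then 1 else 0 :: real)\<^sup>2) = (\<Sum>j\<in>V. if j = p then 1 else 0)"
    by (intro sum.cong) auto
  hence "(\<lambda>j. if j = p then 1 else 0) \<in> ?S" using p V by simp
  hence ne: "?S \<noteq> {}" by (auto simp only: empty_iff)
  have "continuous_on UNIV Q" unfolding Q_def
    by (intro continuous_intros continuous_on_product_coordinates)
  hence cont: "continuous_on ?S Q" by (rule continuous_on_subset) simp
  obtain x where x: "x \<in> ?S" and xmax: "\<forall>y\<in>?S. Q y \<le> Q x"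
    using continuous_attains_sup[OF compact_sphere_fun[OF V(1)] ne cont] by (elim bexE)
  have max: "\<And>y. y \<in> ?S \<Longrightarrow> Q y \<le> Q x" by (rule bspec[OF xmax])
  define mu where "mu = Q x"
  have le: "Q y \<le> mu * (\<Sum>i\<in>V. (y i)\<^sup>2)" for y
  proof (cases "(\<Sum>i\<in>V. (y i)\<^sup>2) = 0")
    case True
    hence "\<And>i. i \<in> V \<Longrightarrow> y i = 0" using sum_nonneg_eq_0_iff[OF V(1), of "\<lambda>i. (y i)\<^sup>2"] by simp
    thus ?thesis by (simp add: Q_def True)
  next
    case False
    define N where "N = (\<Sum>i\<in>V. (y i)\<^sup>2)"
    have N: "N > 0" using False sum_nonneg[of V "\<lambda>i. (y i)\<^sup>2"] by (simp add: N_def order_less_le)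
    let ?z = "\<lambda>j. if j \<in> V then y j / sqrt N else 0"
    have "(\<Sum>j\<in>V. (?z j)\<^sup>2) = (\<Sum>j\<in>V. (y j)\<^sup>2 / N)"
      using N by (intro sum.cong) (auto simp: power_divide)
    hence "(\<Sum>j\<in>V. (?z j)\<^sup>2) = 1" using N by (simp add: sum_divide_distrib[symmetric] N_def[symmetric])
    hence "Q ?z \<le> mu" using max[of ?z] by (simp add: mu_def)
    moreover have "Q ?z = Q y / N"
    proof -
      have "Q ?z = (\<Sum>i\<in>V. (\<Sum>j\<in>V. A i j * (y j / sqrt N)) * (y i / sqrt N))"
        unfolding Q_def by (intro sum.cong refl arg_cong2[where f="(*)"]) auto
      also have "\<dots> = Q y / (sqrt N * sqrt N)"
        unfolding Q_def by (simp add: sum_divide_distrib[symmetric])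
      finally show ?thesis using N by simp
    qed
    ultimately show ?thesis using N by (simp add: N_def[symmetric] field_simps)
  qed
  have x1: "(\<Sum>j\<in>V. (x j)\<^sup>2) = 1" using x by simp
  have eig: "(\<Sum>j\<in>V. A i j * x j) = mu * x i" if i: "i \<in> V" for i
  proof -
    define b where "b = mu * x i - (\<Sum>j\<in>V. A i j * x j)"
    define c where "c = mu - A i i"
    \<comment> \<open>First variation at the maximizer: \<open>x\<close> is moved by
      \<open>t\<close> along the \<open>i\<close>-th unit vector, and \<open>2 * b\<close> is the
      derivative of \<open>mu\<close> times the square norm minus \<open>Q\<close>.\<close>
    have key: "0 \<le> t * (2 * b + t * c)" for t :: real
    proof -
      define e where "e j = (if j = i then t else 0)" for j
      have e1: "(\<Sum>j\<in>V. f j * e j) = t * f i" for f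
      proof -
        have "(\<Sum>j\<in>V. f j * e j) = (\<Sum>j\<in>V. if j = i then t * f j else 0)"
          by (intro sum.cong) (auto simp: e_def)
        thus ?thesis using i V by simp
      qed
      have "Q (\<lambda>j. x j + e j) = Q x + (\<Sum>i\<in>V. (\<Sum>j\<in>V. A i j * x j) * e i)
          + (\<Sum>i\<in>V. (\<Sum>j\<in>V. A i j * e j) * x i) + (\<Sum>i\<in>V. (\<Sum>j\<in>V. A i j * e j) * e i)"
        by (simp add: Q_def sum.distrib algebra_simps)
      also have "\<dots> = Q x + 2 * (t * (\<Sum>j\<in>V. A i j * x j)) + t * (t * A i i)"
        using symmetric_bilinear[of V A e x, OF sym] by (simp add: e1)
      finally have Qxe: "Q (\<lambda>j. x j + e j) = mu + 2 * t * (\<Sum>j\<in>V. A i j * x j) + t * t * A i i"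
        by (simp add: mu_def)
      have "(\<Sum>j\<in>V. (x j + e j)\<^sup>2) = (\<Sum>j\<in>V. (x j)\<^sup>2) + 2 * (\<Sum>j\<in>V. x j * e j) + (\<Sum>j\<in>V. e j * e j)"
        by (simp add: sum.distrib power2_eq_square algebra_simps sum_distrib_left)
      also have "\<dots> = 1 + 2 * t * x i + t * t"
        using x1 by (simp add: e1) (simp add: e_def)
      finally show ?thesis
        using le[of "\<lambda>j. x j + e j"] Qxe by (simp add: b_def c_def algebra_simps)
    qed
    have "b = 0"
    proof (rule ccontr)
      assume b: "b \<noteq> 0"
      \<comment> \<open>For \<open>t = - b / d\<close> with \<open>d\<close> larger than the
        absolute value of \<open>c\<close>, the first-order term outweighs \<open>t * c\<close>, so
        the expression in \<open>key\<close> is negative.\<close>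
      define d where "d = \<bar>c\<bar> + 1"
      have d: "d > 0" "2 * d - c > 0" by (auto simp: d_def abs_if)
      have "(- b / d) * (2 * b + (- b / d) * c) = - (b * b * (2 * d - c) / (d * d))"
        using d(1) by (simp add: field_simps)
      moreover have "b * b * (2 * d - c) / (d * d) > 0"
        using b d by (intro divide_pos_pos mult_pos_pos[of "b * b"]) (auto simp: zero_less_mult_iff)
      ultimately show False using key[of "- b / d"] by linarith
    qed
    thus ?thesis by (simp add: b_def)
  qed
  have "\<exists>j\<in>V. x j \<noteq> 0"
  proof (rule ccontr)
    assume "\<not> ?thesis"
    hence "(\<Sum>j\<in>V. (x j)\<^sup>2) = 0" by (intro sum.neutral) auto
    thus False using x1 by simp
  qed
  hence "is_eigenvalue V A mu" unfolding is_eigenvalue_def using eig by (intro exI[of _ x] conjI ballI)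
  thus ?thesis using le unfolding Q_def by (intro exI[of _ mu] conjI allI)
qed

lemma q_mat_ge_2:
  fixes A :: "'a \<Rightarrow> 'a \<Rightarrow> real"
  assumes V: "finite V" and sym: "\<And>i j. i \<in> V \<Longrightarrow> j \<in> V \<Longrightarrow> A i j = A j i"
    and pq: "p \<in> V" "q \<in> V" "p \<noteq> q" "A p q \<noteq> 0"
  shows "q_mat V A \<ge> 2"
proof -
  have ne: "V \<noteq> {}" using pq by blast
  obtain mu where mu: "is_eigenvalue V A mu"
      "\<And>y. (\<Sum>i\<in>V. (\<Sum>j\<in>V. A i j * y j) * y i) \<le> mu * (\<Sum>i\<in>V. (y i)\<^sup>2)"
    using rayleigh_max[OF V ne, of A] sym by blast
  obtain nu where nu: "is_eigenvalue V (\<lambda>i j. - A i j) nu"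
      "\<And>y. (\<Sum>i\<in>V. (\<Sum>j\<in>V. - A i j * y j) * y i) \<le> nu * (\<Sum>i\<in>V. (y i)\<^sup>2)"
    using rayleigh_max[OF V ne, of "\<lambda>i j. - A i j"] sym by auto
  have nu': "is_eigenvalue V A (- nu)"
    using nu(1) unfolding is_eigenvalue_def by (auto simp: sum_negf minus_equation_iff)
  have "mu \<noteq> - nu"
  proof
    assume eq: "mu = - nu"
    \<comment> \<open>With equal extremes the quadratic form is \<open>mu\<close> times the square
      norm. Polarization then yields \<open>A p q = 0\<close>: unit vectors determine the diagonal,
      and the sum of those at \<open>p\<close> and \<open>q\<close> the entry between them.\<close>
    have Q: "(\<Sum>i\<in>V. (\<Sum>j\<in>V. A i j * y j) * y i) = mu * (\<Sum>i\<in>V. (y i)\<^sup>2)" for y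
      using mu(2)[of y] nu(2)[of y] by (simp add: eq sum_negf)
    have ee: "(\<Sum>j\<in>V. f j * (if j = r then c else 0)) = f r * c" if "r \<in> V" for f r and c :: real
      using V that by (simp add: if_distrib[of "(*) _"] cong: if_cong)
    have diag: "A r r = mu" if "r \<in> V" for r
      using Q[of "\<lambda>j. if j = r then 1 else 0"] that V
      by (simp add: ee power2_eq_square)
    let ?y = "\<lambda>j. (if j = p then 1 else 0) + (if j = q then 1 else 0 :: real)"
    have "(\<Sum>i\<in>V. (\<Sum>j\<in>V. A i j * ?y j) * ?y i) = A p p + A p q + A q p + A q q"
      using pq by (simp add: distrib_left sum.distrib ee)
    moreover have "(\<Sum>i\<in>V. (?y i)\<^sup>2) = 2"
      using pq by (simp add: power2_eq_square distrib_left sum.distrib ee)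
    ultimately show False using Q[of ?y] diag pq sym[of p q] by simp
  qed
  hence "card {mu, - nu} = 2" by simp
  moreover have "{mu, - nu} \<subseteq> {mu. is_eigenvalue V A mu}" using mu(1) nu' by blast
  hence "card {mu, - nu} \<le> card {mu. is_eigenvalue V A mu}"
    by (intro card_mono finite_eigenvalues[OF V sym])
  ultimately show ?thesis unfolding q_mat_def by (simp only:)
qed

text \<open>As (A - s)(A + s) = 0 for s = 1 and s = -1, the column of A + s at \<open>q\<close> is
  an eigenvector for s. It is nonzero for both signs, because its entry at \<open>p\<close> is
  \<open>A p q\<close>.\<close>

lemma q_mat_involution:
  fixes A :: "'a \<Rightarrow> 'a \<Rightarrow> real"
  assumes V: "finite V"
    and sq: "\<And>i j. i \<in> V \<Longrightarrow> j \<in> V \<Longrightarrow> (\<Sum>l\<in>V. A i l * A l j) = (if i = j then 1 else 0)"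
    and pq: "p \<in> V" "q \<in> V" "p \<noteq> q" "A p q \<noteq> 0"
  shows "q_mat V A = 2"
proof -
  have col: "is_eigenvalue V A s" if s: "s * s = 1" for s
  proof -
    let ?x = "\<lambda>j. A j q + s * (if j = q then 1 else 0)"
    have "(\<Sum>j\<in>V. A i j * ?x j) = s * ?x i" if i: "i \<in> V" for i
    proof -
      have "(\<Sum>j\<in>V. A i j * (s * (if j = q then 1 else 0))) = s * A i q"
        using V pq(2) by (simp add: if_distrib[of "(*) _"] cong: if_cong)
      hence "(\<Sum>j\<in>V. A i j * ?x j) = (if i = q then 1 else 0) + s * A i q"
        using sq[OF i pq(2)] by (simp add: distrib_left sum.distrib)
      also have "\<dots> = s * ?x i" using s by (simp add: distrib_left mult.assoc[symmetric])
      finally show ?thesis .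
    qed
    moreover have "?x p \<noteq> 0" using pq by simp
    ultimately show ?thesis unfolding is_eigenvalue_def using pq(1)
      by (intro exI[of _ ?x] conjI ballI bexI[of _ p])
  qed
  have "mu = 1 \<or> mu = -1" if ev: "is_eigenvalue V A mu" for mu
  proof -
    obtain x where x0: "\<exists>j\<in>V. x j \<noteq> 0" and x: "\<forall>i\<in>V. (\<Sum>j\<in>V. A i j * x j) = mu * x i"
      using ev unfolding is_eigenvalue_def by (elim exE conjE)
    have xs: "mu * x i = (\<Sum>j\<in>V. A i j * x j)" if "i \<in> V" for i using x that by simp
    obtain r where r: "r \<in> V" "x r \<noteq> 0" using x0 by blast
    have "mu * mu * x r = (\<Sum>i\<in>V. A r i * (mu * x i))"
      using x r(1) by (simp add: mult.left_commute sum_distrib_left[symmetric])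
    also have "\<dots> = (\<Sum>i\<in>V. \<Sum>j\<in>V. A r i * A i j * x j)"
      by (simp add: xs sum_distrib_left mult.assoc)
    also have "\<dots> = (\<Sum>j\<in>V. (\<Sum>i\<in>V. A r i * A i j) * x j)"
      by (subst sum.swap) (simp add: sum_distrib_right)
    also have "\<dots> = x r"
      using V r(1) by (simp add: sq if_distrib[of "\<lambda>x. x * _"] cong: if_cong)
    finally have "mu * mu = 1" using r(2) by simp
    thus ?thesis by (simp add: square_eq_1_iff)
  qed
  hence "{mu. is_eigenvalue V A mu} = {1, -1}" using col[of 1] col[of "-1"] by auto
  thus ?thesis unfolding q_mat_def by simp
qed

section \<open>Eigenvectors of perturbed diagonal matrices\<close>

lemma finite_positive_lower_bound:
  fixes f :: "'i \<Rightarrow> real"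
  assumes "finite I" "\<And>i. i \<in> I \<Longrightarrow> f i > 0"
  shows "\<exists>d>0. \<forall>i\<in>I. d < f i"
  using assms
proof (induction rule: finite_induct)
  case empty
  show ?case by (intro exI[of _ 1]) simp
next
  case (insert i I)
  then obtain d where "d > 0" "\<forall>i\<in>I. d < f i" by auto
  moreover have "f i > 0" using insert.prems by simp
  ultimately show ?case
    by (intro exI[of _ "min d (f i / 2)"]) (auto simp: min_less_iff_disj)
qed

text \<open>Banach's theorem for the sup distance over \<open>K\<close>. A uniform bound
  \<open>r\<close> on the coordinates takes the place of the supremum, so functions that differ off
  \<open>K\<close> cause no trouble.\<close>

lemma box_contraction_fixpoint:
  fixes T :: "('k \<Rightarrow> real) \<Rightarrow> 'k \<Rightarrow> real"
  assumes box: "\<And>X. \<forall>k\<in>K. \<bar>X k\<bar> \<le> 1 \<Longrightarrow> \<forall>k\<in>K. \<bar>T X k\<bar> \<le> 1"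
    and contr: "\<And>X Y r. \<forall>k\<in>K. \<bar>X k\<bar> \<le> 1 \<Longrightarrow> \<forall>k\<in>K. \<bar>Y k\<bar> \<le> 1 \<Longrightarrow> \<forall>k\<in>K. \<bar>X k - Y k\<bar> \<le> r
                  \<Longrightarrow> \<forall>k\<in>K. \<bar>T X k - T Y k\<bar> \<le> r / 2"
  shows "\<exists>X. (\<forall>k\<in>K. \<bar>X k\<bar> \<le> 1) \<and> (\<forall>k\<in>K. T X k = X k)"
proof -
  define x where "x n = (T ^^ n) (\<lambda>_. 0)" for n
  have x_Suc: "x (Suc n) = T (x n)" for n by (simp add: x_def)
  have xbox: "\<forall>k\<in>K. \<bar>x n k\<bar> \<le> 1" for n
  proof (induction n)
    case 0 show ?case by (simp add: x_def)
  next
    case (Suc n) show ?case unfolding x_Suc by (rule box[OF Suc])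
  qed
  \<comment> \<open>All later iterates are compared with \<open>x n\<close> at once: the box bounds
    the case \<open>n = 0\<close>, and every further step halves the distance. No geometric series
    has to be summed.\<close>
  have step: "\<forall>k\<in>K. \<bar>x (n + m) k - x n k\<bar> \<le> (1/2) ^ n" for n m
  proof (induction n)
    case 0 show ?case using xbox[of m] by (simp add: x_def)
  next
    case (Suc n)
    show ?case using contr[OF xbox xbox Suc] by (simp add: x_Suc)
  qed
  have lim: "(\<lambda>n. (1/2::real) ^ n) \<longlonglongrightarrow> 0" by (rule LIMSEQ_power_zero) simp
  have "\<exists>L. (\<lambda>n. x n k) \<longlonglongrightarrow> L" if k: "k \<in> K" for k
  proof -
    have "Cauchy (\<lambda>n. x n k)"
    proof (rule metric_CauchyI)
      fix e :: real assume "e > 0"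
      then obtain N where N: "(1/2::real) ^ N < e / 2"
        using real_arch_pow_inv[of "e/2" "1/2"] by auto
      have near: "\<bar>x n k - x N k\<bar> < e / 2" if "n \<ge> N" for n
        using step[of N "n - N"] k that N by fastforce
      have "dist (x m k) (x n k) < e" if "m \<ge> N" "n \<ge> N" for m n
        using near[OF that(1)] near[OF that(2)] unfolding dist_real_def by linarith
      thus "\<exists>M. \<forall>m\<ge>M. \<forall>n\<ge>M. dist (x m k) (x n k) < e" by blast
    qed
    thus ?thesis by (simp add: Cauchy_convergent_iff convergent_def)
  qed
  then obtain L where L: "\<And>k. k \<in> K \<Longrightarrow> (\<lambda>n. x n k) \<longlonglongrightarrow> L k" by metis
  have Lbox: "\<forall>k\<in>K. \<bar>L k\<bar> \<le> 1"
  proof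
    fix k assume k: "k \<in> K"
    have "(\<lambda>n. \<bar>x n k\<bar>) \<longlonglongrightarrow> \<bar>L k\<bar>" using L[OF k] by (rule tendsto_rabs)
    thus "\<bar>L k\<bar> \<le> 1" by (rule LIMSEQ_le_const2) (use xbox k in auto)
  qed
  have Lx: "\<forall>k\<in>K. \<bar>L k - x n k\<bar> \<le> (1/2) ^ n" for n
  proof
    fix k assume k: "k \<in> K"
    have "(\<lambda>m. \<bar>x (m + n) k - x n k\<bar>) \<longlonglongrightarrow> \<bar>L k - x n k\<bar>"
      by (intro tendsto_intros LIMSEQ_ignore_initial_segment L k)
    thus "\<bar>L k - x n k\<bar> \<le> (1/2) ^ n"
      by (rule LIMSEQ_le_const2) (use step[of n] k in \<open>auto simp: add.commute\<close>)
  qed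
  have "T L k = L k" if k: "k \<in> K" for k
  proof -
    have "\<bar>T L k - x (Suc n) k\<bar> \<le> (1/2) ^ n / 2" for n
      using contr[OF Lbox xbox Lx, of n] k by (simp add: x_Suc)
    moreover have "\<bar>L k - x (Suc n) k\<bar> \<le> (1/2) ^ n / 2" for n
      using Lx[of "Suc n"] k by simp
    ultimately have "\<bar>T L k - L k\<bar> \<le> (1/2) ^ n" for n
      by (smt (verit) field_sum_of_halves)
    hence "\<bar>T L k - L k\<bar> \<le> 0" by (intro LIMSEQ_le_const[OF lim]) auto
    thus ?thesis by simp
  qed
  thus ?thesis using Lbox by blast
qed

text \<open>The contraction factor of the fixed point map below. Changing the numerator costs at
  most \<open>r / 4\<close> and changing the denominator at most \<open>r / 16\<close>.\<close>

lemma quotient_difference_bound: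
  fixes s s' p q g r :: real
  assumes g: "g > 0" and r: "r \<ge> 0" and s: "\<bar>s - s'\<bar> \<le> g / 8 * r" and s': "\<bar>s'\<bar> \<le> g / 8"
    and pq: "\<bar>p - q\<bar> \<le> g / 8 * r" and p: "g / 2 \<le> \<bar>p\<bar>" and q: "g / 2 \<le> \<bar>q\<bar>"
  shows "\<bar>s / p - s' / q\<bar> \<le> r / 2"
proof -
  have nz: "p \<noteq> 0" "q \<noteq> 0" using p q g by auto
  have "\<bar>(s - s') / p\<bar> \<le> (g / 8 * r) / (g / 2)"
    unfolding abs_divide using s p g r by (intro frac_le) auto
  also have "\<dots> = r / 4" using g by simp
  finally have 1: "\<bar>(s - s') / p\<bar> \<le> r / 4" .
  have "\<bar>s'\<bar> * \<bar>p - q\<bar> \<le> g / 8 * (g / 8 * r)"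
    using s' pq g r by (intro mult_mono) auto
  moreover have "g / 2 * (g / 2) \<le> \<bar>p\<bar> * \<bar>q\<bar>"
    using p q g by (intro mult_mono) auto
  ultimately have "\<bar>s'\<bar> * \<bar>p - q\<bar> / (\<bar>p\<bar> * \<bar>q\<bar>) \<le> (g / 8 * (g / 8 * r)) / (g / 2 * (g / 2))"
    using g r by (intro frac_le) auto
  also have "\<dots> = r / 16" using g by simp
  finally have 2: "\<bar>s' * (p - q) / (p * q)\<bar> \<le> r / 16" by (simp add: abs_mult)
  have "s / p - s' / q = (s - s') / p - s' * (p - q) / (p * q)"
    using nz by (simp add: field_simps)
  thus ?thesis using 1 2 r by linarith
qed

text \<open>With \<open>X l l\<close> normalized to 1, the eigenvector equation at
  \<open>a = l\<close> can be solved for the diagonal entry \<open>d l\<close>. Substituting this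
  into the equations with \<open>a \<noteq> l\<close> leaves \<open>X\<close> as the only unknown
  and turns them into a fixed point equation.\<close>

lemma perturbed_diagonal_eigenvectors:
  fixes lam :: "'a \<Rightarrow> real" and E :: "'a \<Rightarrow> 'a \<Rightarrow> real"
  assumes V: "finite V" and g: "g > 0"
    and gap: "\<And>l a. l \<in> V \<Longrightarrow> a \<in> V \<Longrightarrow> l \<noteq> a \<Longrightarrow> g \<le> \<bar>lam l - lam a\<bar>"
    and E: "\<And>a b. \<bar>E a b\<bar> \<le> 1" "\<And>a. E a a = 0"
    and eps: "0 \<le> eps" "eps * real (card V) \<le> g / 8"
  shows "\<exists>(X :: 'a \<Rightarrow> 'a \<Rightarrow> real) d. (\<forall>l\<in>V. X l l = 1) \<and> (\<forall>l\<in>V. \<forall>a\<in>V. \<bar>X l a\<bar> \<le> 1) \<and> (\<forall>a\<in>V. \<bar>d a - lam a\<bar> \<le> g / 8)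
    \<and> (\<forall>l\<in>V. \<forall>a\<in>V. d a * X l a + eps * (\<Sum>b\<in>V. E a b * X l b) = lam l * X l a)"
proof -
  define S where "S X l a = eps * (\<Sum>b\<in>V. E a b * X (l, b))" for X :: "'a \<times> 'a \<Rightarrow> real" and l a
  define D where "D X a = lam a - S X a a" for X a
  define T where "T X = (\<lambda>(l, a). if l = a then 1 else S X l a / (lam l - D X a))" for X
  let ?K = "V \<times> V"
  have Sr: "\<bar>eps * (\<Sum>b\<in>V. E a b * f b)\<bar> \<le> g / 8 * r" if f: "\<And>b. b \<in> V \<Longrightarrow> \<bar>f b\<bar> \<le> r" and r: "r \<ge> 0" for a f r
  proof -
    have "\<bar>E a b * f b\<bar> \<le> r" if "b \<in> V" for b
      using mult_mono[OF E(1)[of a b] f[OF that]] by (simp add: abs_mult)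
    hence "(\<Sum>b\<in>V. \<bar>E a b * f b\<bar>) \<le> real (card V) * r" by (rule sum_bounded_above)
    hence "\<bar>\<Sum>b\<in>V. E a b * f b\<bar> \<le> real (card V) * r" by (rule order_trans[OF sum_abs])
    hence "\<bar>eps * (\<Sum>b\<in>V. E a b * f b)\<bar> \<le> eps * (real (card V) * r)"
      using eps(1) by (simp add: abs_mult mult_left_mono)
    also have "\<dots> \<le> g / 8 * r" using mult_right_mono[OF eps(2) r] by (simp add: mult.assoc)
    finally show ?thesis .
  qed
  have S1: "\<bar>S X l a\<bar> \<le> g / 8" if "\<forall>k\<in>?K. \<bar>X k\<bar> \<le> 1" "l \<in> V" for X l a
    unfolding S_def using Sr[of "\<lambda>b. X (l, b)" 1 a] that by auto
  have Sd: "\<bar>S X l a - S Y l a\<bar> \<le> g / 8 * r" if "\<forall>k\<in>?K. \<bar>X k - Y k\<bar> \<le> r" "l \<in> V" for X Y l a r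
  proof -
    have "\<bar>X (l, l) - Y (l, l)\<bar> \<le> r" using that by blast
    hence "r \<ge> 0" by linarith
    moreover have "S X l a - S Y l a = eps * (\<Sum>b\<in>V. E a b * (X (l, b) - Y (l, b)))"
      by (simp add: S_def right_diff_distrib sum_subtractf)
    ultimately show ?thesis using Sr[of "\<lambda>b. X (l, b) - Y (l, b)" r a] that by auto
  qed
  \<comment> \<open>The diagonal moves by at most \<open>g / 8\<close> from \<open>lam\<close>, so a
    gap of \<open>g\<close> leaves denominators of at least \<open>g / 2\<close>.\<close>
  have P: "g / 2 \<le> \<bar>lam l - D X a\<bar>" if "\<forall>k\<in>?K. \<bar>X k\<bar> \<le> 1" "l \<in> V" "a \<in> V" "l \<noteq> a" for X l a
    using S1[OF that(1,3), of a] gap[OF that(2-4)] g unfolding D_def by linarith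
  have "\<exists>X. (\<forall>k\<in>?K. \<bar>X k\<bar> \<le> 1) \<and> (\<forall>k\<in>?K. T X k = X k)"
  proof (rule box_contraction_fixpoint)
    fix X :: "'a \<times> 'a \<Rightarrow> real" assume X: "\<forall>k\<in>?K. \<bar>X k\<bar> \<le> 1"
    have "\<bar>T X (l, a)\<bar> \<le> 1" if la: "l \<in> V" "a \<in> V" for l a
    proof (cases "l = a")
      case False
      have "\<bar>S X l a\<bar> / \<bar>lam l - D X a\<bar> \<le> (g / 8) / (g / 2)"
        using S1[OF X la(1)] P[OF X la False] g by (intro frac_le) auto
      also have "\<dots> \<le> 1" using g by simp
      finally show ?thesis using False by (simp add: T_def)
    qed (simp add: T_def)
    thus "\<forall>k\<in>?K. \<bar>T X k\<bar> \<le> 1" by auto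
  next
    fix X Y :: "'a \<times> 'a \<Rightarrow> real" and r
    assume X: "\<forall>k\<in>?K. \<bar>X k\<bar> \<le> 1" and Y: "\<forall>k\<in>?K. \<bar>Y k\<bar> \<le> 1" and XY: "\<forall>k\<in>?K. \<bar>X k - Y k\<bar> \<le> r"
    have "\<bar>T X (l, a) - T Y (l, a)\<bar> \<le> r / 2" if la: "l \<in> V" "a \<in> V" for l a
    proof -
      have "\<bar>X (l, a) - Y (l, a)\<bar> \<le> r" using XY la by blast
      hence r: "r \<ge> 0" by linarith
      show ?thesis
      proof (cases "l = a")
        case True thus ?thesis using r by (simp add: T_def)
      next
        case False
        have "\<bar>S X l a / (lam l - D X a) - S Y l a / (lam l - D Y a)\<bar> \<le> r / 2"
        proof (rule quotient_difference_bound[OF g r Sd[OF XY la(1)] S1[OF Y la(1)]])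
          show "\<bar>(lam l - D X a) - (lam l - D Y a)\<bar> \<le> g / 8 * r"
            using Sd[OF XY la(2), of a] by (simp add: D_def abs_minus_commute)
        qed (use P[OF X la False] P[OF Y la False] in auto)
        thus ?thesis using False r by (simp add: T_def)
      qed
    qed
    thus "\<forall>k\<in>?K. \<bar>T X k - T Y k\<bar> \<le> r / 2" by auto
  qed
  then obtain X where X: "\<forall>k\<in>?K. \<bar>X k\<bar> \<le> 1" and fp: "\<forall>k\<in>?K. T X k = X k" by blast
  have one: "X (l, l) = 1" if "l \<in> V" for l using fp that by (force simp: T_def)
  have eq: "D X a * X (l, a) + S X l a = lam l * X (l, a)" if la: "l \<in> V" "a \<in> V" for l a
  proof (cases "l = a")
    case True thus ?thesis using one la by (simp add: D_def)
  next
    case False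
    have "X (l, a) = S X l a / (lam l - D X a)" using fp la False by (force simp: T_def)
    moreover have "lam l - D X a \<noteq> 0" using P[OF X la False] g by auto
    ultimately show ?thesis by (simp add: field_simps)
  qed
  show ?thesis
    by (intro exI[of _ "\<lambda>l a. X (l, a)"] exI[of _ "D X"])
       (use X one eq S1[OF X] in \<open>auto simp: S_def D_def\<close>)
qed

section \<open>Spanning trees and their distance functions\<close>

text \<open>
  \<^term>\<open>t\<close> is the edge relation of a tree on \<^term>\<open>S\<close> and \<^term>\<open>D\<close> its distance function: seen from a
  root \<^term>\<open>l\<close>, every other vertex has exactly one neighbour that is nearer to \<^term>\<open>l\<close>.
\<close>
definition tree_metric :: "'a set \<Rightarrow> ('a \<Rightarrow> 'a \<Rightarrow> bool) \<Rightarrow> ('a \<Rightarrow> 'a \<Rightarrow> nat) \<Rightarrow> bool" where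
  "tree_metric S t D \<longleftrightarrow>
     (\<forall>a b. t a b \<longrightarrow> a \<in> S \<and> b \<in> S \<and> t b a \<and> D a b = 1)
     \<and> (\<forall>a\<in>S. D a a = 0)
     \<and> (\<forall>l\<in>S. \<forall>a\<in>S. D l a < card S)
     \<and> (\<forall>l\<in>S. \<forall>a\<in>S. l \<noteq> a \<longrightarrow>
          (\<exists>p. t a p \<and> D l a = Suc (D l p) \<and> (\<forall>b. t a b \<longrightarrow> b \<noteq> p \<longrightarrow> D l b = Suc (D l a))))"

text \<open>The new vertex is a leaf attached at \<open>p\<close>. Seen from the root
  \<open>v\<close>, the parent of \<open>p\<close> is \<open>v\<close> and every other old vertex
  keeps the parent that it has from \<open>p\<close>. Seen from an old root, old parents persist and
  \<open>v\<close> hangs below \<open>p\<close>.\<close>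

lemma tree_metric_extend:
  assumes T: "tree_metric S t D" and S: "finite S" and p: "p \<in> S" and v: "v \<notin> S"
  shows "tree_metric (insert v S) (\<lambda>a b. t a b \<or> a = v \<and> b = p \<or> a = p \<and> b = v)
    (\<lambda>l a. if l = v then if a = v then 0 else Suc (D p a) else if a = v then Suc (D l p) else D l a)"
    (is "tree_metric _ ?t ?D")
proof -
  have t: "a \<in> S \<and> b \<in> S \<and> t b a \<and> D a b = 1" if "t a b" for a b
    using T that unfolding tree_metric_def by blast
  have D0: "D a a = 0" if "a \<in> S" for a using T that unfolding tree_metric_def by blast
  have Dc: "D l a < card S" if "l \<in> S" "a \<in> S" for l a using T that unfolding tree_metric_def by blast
  have par: "\<exists>p. t a p \<and> D l a = Suc (D l p) \<and> (\<forall>b. t a b \<longrightarrow> b \<noteq> p \<longrightarrow> D l b = Suc (D l a))"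
    if "l \<in> S" "a \<in> S" "l \<noteq> a" for l a using T that unfolding tree_metric_def by blast
  have tv: "\<not> t v b" "\<not> t b v" for b using t v by blast+
  have nv: "b \<noteq> v" if "t a b" for a b using tv that by blast
  have 1: "a \<in> insert v S \<and> b \<in> insert v S \<and> ?t b a \<and> ?D a b = 1" if "?t a b" for a b
    using that t[of a b] p v D0[OF p] by auto
  have 2: "?D a a = 0" if "a \<in> insert v S" for a using that D0 by auto
  have 3: "?D l a < card (insert v S)" if "l \<in> insert v S" "a \<in> insert v S" for l a
    using that S v Dc p by (auto simp: Suc_lessI less_SucI)
  have 4: "\<exists>q. ?t a q \<and> ?D l a = Suc (?D l q) \<and> (\<forall>b. ?t a b \<longrightarrow> b \<noteq> q \<longrightarrow> ?D l b = Suc (?D l a))"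
    if la: "l \<in> insert v S" "a \<in> insert v S" "l \<noteq> a" for l a
  proof (cases "a = v")
    case True
    hence "l \<noteq> v" using la(3) by simp
    thus ?thesis using True tv by (intro exI[of _ p]) (use p v in auto)
  next
    case aS: False
    hence a: "a \<in> S" using la by simp
    show ?thesis
    proof (cases "l = v")
      case lv: True
      show ?thesis
      proof (cases "a = p")
        case True
        thus ?thesis using lv aS D0[OF p] t tv by (intro exI[of _ v]) auto
      next
        case False
        obtain q where q: "t a q" "D p a = Suc (D p q)" "\<And>b. t a b \<Longrightarrow> b \<noteq> q \<Longrightarrow> D p b = Suc (D p a)"
          using par[OF p a] False by blast
        show ?thesis
        proof (intro exI[of _ q] conjI allI impI)
          show "?D l a = Suc (?D l q)" using lv aS q(2) nv[OF q(1)] by simp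
          fix b assume b: "?t a b" "b \<noteq> q"
          hence "t a b" using aS False by blast
          thus "?D l b = Suc (?D l a)" using lv aS q(3) b(2) nv by simp
        qed (use q(1) in simp)
      qed
    next
      case lv: False
      hence l: "l \<in> S" using la by simp
      obtain q where q: "t a q" "D l a = Suc (D l q)" "\<And>b. t a b \<Longrightarrow> b \<noteq> q \<Longrightarrow> D l b = Suc (D l a)"
        using par[OF l a la(3)] by blast
      show ?thesis
      proof (intro exI[of _ q] conjI allI impI)
        show "?D l a = Suc (?D l q)" using lv aS q(2) nv[OF q(1)] by simp
        fix b assume b: "?t a b" "b \<noteq> q"
        show "?D l b = Suc (?D l a)"
        proof (cases "b = v")
          case True thus ?thesis using lv aS b(1) tv by simp
        next
          case False
          hence "t a b" using aS b(1) by simp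
          thus ?thesis using lv aS q(3) b(2) False by simp
        qed
      qed (use q(1) in simp)
    qed
  qed
  show ?thesis unfolding tree_metric_def
  proof (intro conjI)
    show "\<forall>a b. ?t a b \<longrightarrow> a \<in> insert v S \<and> b \<in> insert v S \<and> ?t b a \<and> ?D a b = 1"
      by (intro allI impI) (rule 1)
    show "\<forall>a\<in>insert v S. ?D a a = 0" by (intro ballI) (rule 2)
    show "\<forall>l\<in>insert v S. \<forall>a\<in>insert v S. ?D l a < card (insert v S)" by (intro ballI) (rule 3)
    show "\<forall>l\<in>insert v S. \<forall>a\<in>insert v S. l \<noteq> a \<longrightarrow>
        (\<exists>q. ?t a q \<and> ?D l a = Suc (?D l q) \<and> (\<forall>b. ?t a b \<longrightarrow> b \<noteq> q \<longrightarrow> ?D l b = Suc (?D l a)))"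
      by (intro ballI impI) (rule 4)
  qed
qed

lemma connected_boundary_edge:
  assumes G: "connected_graph G" and S: "S \<subseteq> verts G" "S \<noteq> {}" "S \<noteq> verts G"
  shows "\<exists>p v. p \<in> S \<and> v \<in> verts G \<and> v \<notin> S \<and> adj G p v"
proof -
  obtain a b where a: "a \<in> S" and b: "b \<in> verts G" "b \<notin> S" using S by blast
  have "(adj G)\<^sup>*\<^sup>* a b" using G a b S(1) unfolding connected_graph_def by blast
  hence "b \<notin> S \<longrightarrow> (\<exists>p v. p \<in> S \<and> v \<notin> S \<and> adj G p v)"
    by (induction rule: rtranclp_induct) (use a in auto)
  then obtain p v where "p \<in> S" "v \<notin> S" "adj G p v" using b by blast
  thus ?thesis using G unfolding connected_graph_def simple_graph_def by blast
qed

lemma spanning_tree: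
  assumes G: "connected_graph G"
  shows "\<exists>t D. tree_metric (verts G) t D \<and> (\<forall>a b. t a b \<longrightarrow> adj G a b)"
proof -
  have fin: "finite (verts G)" and ne: "verts G \<noteq> {}" and sym: "\<And>u v. adj G u v \<Longrightarrow> adj G v u"
    using G unfolding connected_graph_def simple_graph_def by blast+
  have "\<exists>S t D. S \<subseteq> verts G \<and> card S = Suc n \<and> tree_metric S t D \<and> (\<forall>a b. t a b \<longrightarrow> adj G a b)"
    if "Suc n \<le> card (verts G)" for n
    using that
  proof (induction n)
    case 0
    obtain r where "r \<in> verts G" using ne by blast
    thus ?case
      by (intro exI[of _ "{r}"] exI[of _ "\<lambda>_ _. False"] exI[of _ "\<lambda>_ _. 0"])
         (auto simp: tree_metric_def)
  next
    case (Suc n)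
    then obtain S t D where IH: "S \<subseteq> verts G" "card S = Suc n" "tree_metric S t D"
        "\<forall>a b. t a b \<longrightarrow> adj G a b" by auto
    have "S \<noteq> {}" "S \<noteq> verts G" using IH Suc.prems by auto
    then obtain p v where pv: "p \<in> S" "v \<in> verts G" "v \<notin> S" "adj G p v"
      using connected_boundary_edge[OF G IH(1)] by blast
    have S: "finite S" using IH(1) fin finite_subset by blast
    have "insert v S \<subseteq> verts G" "card (insert v S) = Suc (Suc n)" using IH pv S by auto
    moreover have "adj G a b" if "t a b \<or> a = v \<and> b = p \<or> a = p \<and> b = v" for a b
      using that IH(4) pv(4) sym by blast
    ultimately show ?case using tree_metric_extend[OF IH(3) S pv(1,3)] by blast
  qed
  from this[of "card (verts G) - 1"] obtain S t D where "S \<subseteq> verts G" "card S = card (verts G)"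
      "tree_metric S t D" "\<forall>a b. t a b \<longrightarrow> adj G a b"
    using fin ne by (metis Suc_pred' card_gt_0_iff order_refl)
  thus ?thesis using fin card_subset_eq by blast
qed

section \<open>Orders of magnitude of eigenvector entries along a tree\<close>

text \<open>Each edge away from the root costs a factor \<open>eps\<close>: tree neighbours of
  \<open>a\<close> are at most one step nearer to \<open>l\<close>, and the other weights
  \<open>eps ^ n\<close> are small enough by themselves. The bound is stated for every
  \<open>k \<le> D l a\<close>, since the induction also needs it for neighbours farther away. In
  \<open>K\<close>, the \<open>n\<close> summands are divided by the eigenvalue distance
  \<open>g / 2\<close>.\<close>

lemma tree_weighted_eigenvectors_upper:
  fixes X E :: "'a \<Rightarrow> 'a \<Rightarrow> real"
  assumes V: "finite V" and T: "tree_metric V t D" and n: "n = card V"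
    and g: "0 < g" "g \<le> 1" and K: "K = 2 * real n / g" and eps: "0 < eps" "eps \<le> 1"
    and E1: "\<And>a b. \<bar>E a b\<bar> \<le> 1"
    and E: "\<And>a b. \<not> t a b \<Longrightarrow> \<bar>E a b\<bar> \<le> eps ^ n"
    and X1: "\<And>l a. l \<in> V \<Longrightarrow> a \<in> V \<Longrightarrow> \<bar>X l a\<bar> \<le> 1"
    and eq: "\<And>l a. l \<in> V \<Longrightarrow> a \<in> V \<Longrightarrow> l \<noteq> a \<Longrightarrow>
               \<bar>X l a\<bar> * g / 2 \<le> eps * \<bar>\<Sum>b\<in>V. E a b * X l b\<bar>"
    and l: "l \<in> V"
  shows "a \<in> V \<Longrightarrow> k \<le> n \<Longrightarrow> k \<le> D l a \<Longrightarrow> \<bar>X l a\<bar> \<le> K ^ k * eps ^ k"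
proof (induction k arbitrary: a)
  case 0
  thus ?case using X1 l by simp
next
  case (Suc k)
  have "n \<ge> 1" using l V n by (metis One_nat_def Suc_leI card_gt_0_iff empty_iff)
  hence "1 \<le> 2 * real n" by simp
  hence K1: "K \<ge> 1" using g unfolding K by (simp add: le_divide_eq)
  have D0: "D l l = 0" using T l unfolding tree_metric_def by blast
  have la: "l \<noteq> a" using Suc.prems D0 by auto
  obtain p where p: "t a p" "D l a = Suc (D l p)"
      and q: "\<And>b. t a b \<Longrightarrow> b \<noteq> p \<Longrightarrow> D l b = Suc (D l a)"
    using T l Suc.prems(1) la unfolding tree_metric_def by blast
  have "\<bar>E a b * X l b\<bar> \<le> K ^ k * eps ^ k" if b: "b \<in> V" for b
  proof (cases "t a b")
    case True
    have "k \<le> D l b" using p q[OF True] Suc.prems(3) by (cases "b = p") auto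
    hence "\<bar>X l b\<bar> \<le> K ^ k * eps ^ k" using Suc.IH[OF b] Suc.prems(2) by simp
    moreover have "\<bar>E a b * X l b\<bar> \<le> \<bar>X l b\<bar>"
      unfolding abs_mult using mult_right_mono[OF E1[of a b], of "\<bar>X l b\<bar>"] by simp
    ultimately show ?thesis by linarith
  next
    case False
    have "\<bar>E a b * X l b\<bar> \<le> eps ^ n * 1"
      unfolding abs_mult using E[OF False] X1[OF l b] eps by (intro mult_mono) auto
    also have "eps ^ n * 1 \<le> 1 * eps ^ k" using eps Suc.prems(2) by (simp add: power_decreasing)
    also have "\<dots> \<le> K ^ k * eps ^ k" using K1 eps by (intro mult_right_mono one_le_power) auto
    finally show ?thesis .
  qed
  hence "(\<Sum>b\<in>V. \<bar>E a b * X l b\<bar>) \<le> real n * (K ^ k * eps ^ k)"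
    unfolding n by (rule sum_bounded_above)
  hence "\<bar>\<Sum>b\<in>V. E a b * X l b\<bar> \<le> real n * (K ^ k * eps ^ k)" by (rule order_trans[OF sum_abs])
  hence "eps * \<bar>\<Sum>b\<in>V. E a b * X l b\<bar> \<le> eps * (real n * (K ^ k * eps ^ k))"
    using eps by (intro mult_left_mono) auto
  hence "\<bar>X l a\<bar> * g / 2 \<le> eps * (real n * (K ^ k * eps ^ k))"
    using eq[OF l Suc.prems(1) la] by linarith
  hence "\<bar>X l a\<bar> \<le> eps * (real n * (K ^ k * eps ^ k)) * 2 / g"
    using g by (simp add: field_simps)
  also have "\<dots> = K ^ Suc k * eps ^ Suc k" by (simp add: K)
  finally show ?case .
qed

text \<open>In the equation at \<open>a\<close>, the parent \<open>p\<close> contributes order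
  \<open>eps ^ k\<close>, the remaining vertices only \<open>eps ^ Suc k\<close>. By
  \<open>small\<close> they cancel at most half of the parent's term. This is the 2 in
  \<open>1 / (2 * L)\<close>; the \<open>L\<close> bounds the eigenvalue distance by which the sum
  is divided.\<close>

lemma tree_weighted_eigenvectors_lower:
  fixes X E :: "'a \<Rightarrow> 'a \<Rightarrow> real"
  assumes V: "finite V" and T: "tree_metric V t D" and n: "n = card V"
    and K: "K \<ge> 1" and eps: "0 < eps" "eps \<le> 1" and L: "L \<ge> 1"
    and small: "real n * K ^ n * eps \<le> (1 / (2 * L)) ^ n / 2"
    and Et: "\<And>a b. t a b \<Longrightarrow> E a b = 1"
    and E: "\<And>a b. \<not> t a b \<Longrightarrow> \<bar>E a b\<bar> \<le> eps ^ n"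
    and X0: "\<And>l. l \<in> V \<Longrightarrow> X l l = 1"
    and X1: "\<And>l a. l \<in> V \<Longrightarrow> a \<in> V \<Longrightarrow> \<bar>X l a\<bar> \<le> 1"
    and Xu: "\<And>a k. a \<in> V \<Longrightarrow> k \<le> n \<Longrightarrow> k \<le> D l a \<Longrightarrow> \<bar>X l a\<bar> \<le> K ^ k * eps ^ k"
    and eq: "\<And>l a. l \<in> V \<Longrightarrow> a \<in> V \<Longrightarrow> l \<noteq> a \<Longrightarrow>
               eps * \<bar>\<Sum>b\<in>V. E a b * X l b\<bar> \<le> \<bar>X l a\<bar> * L"
    and l: "l \<in> V"
  shows "a \<in> V \<Longrightarrow> D l a = k \<Longrightarrow> (1 / (2 * L)) ^ k * eps ^ k \<le> \<bar>X l a\<bar>"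
proof (induction k arbitrary: a)
  case 0
  have "a = l" using T 0 l unfolding tree_metric_def by (metis Zero_not_Suc)
  thus ?case using X0 l by simp
next
  case (Suc k)
  let ?c = "1 / (2 * L)"
  have c: "0 < ?c" "?c \<le> 1" using L by auto
  have D0: "D l l = 0" using T l unfolding tree_metric_def by blast
  have la: "l \<noteq> a" using Suc.prems D0 by auto
  have t: "b \<in> V" if "t a b" for b using T that unfolding tree_metric_def by blast
  have Dn: "D l b < n" if "b \<in> V" for b using T that l n unfolding tree_metric_def by blast
  obtain p where p: "t a p" "D l a = Suc (D l p)"
      and q: "\<And>b. t a b \<Longrightarrow> b \<noteq> p \<Longrightarrow> D l b = Suc (D l a)"
    using T l Suc.prems(1) la unfolding tree_metric_def by blast
  \<comment> \<open>Distances are below \<open>n\<close>, so the weight \<open>eps ^ n\<close> off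
    the tree is at most \<open>eps ^ Suc k\<close>, one order smaller than the parent's
    term.\<close>
  have kn: "Suc k < n" using Dn[OF Suc.prems(1)] Suc.prems(2) by simp
  have "\<bar>E a b * X l b\<bar> \<le> K ^ n * eps ^ Suc k" if b: "b \<in> V - {p}" for b
  proof (cases "t a b")
    case True
    have Db: "D l b = Suc (Suc k)" using q[OF True] b Suc.prems(2) by simp
    have "\<bar>X l b\<bar> \<le> K ^ Suc (Suc k) * eps ^ Suc (Suc k)"
      using Xu[of b "Suc (Suc k)"] b Dn[of b] Db by simp
    also have "\<dots> \<le> K ^ n * eps ^ Suc k"
      using K eps Dn[of b] b Db
      by (intro mult_mono power_increasing power_decreasing) auto
    finally show ?thesis using Et[OF True] by simp
  next
    case False
    have "\<bar>E a b * X l b\<bar> \<le> eps ^ n * 1"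
      unfolding abs_mult using E[OF False] X1[OF l, of b] b eps by (intro mult_mono) auto
    also have "eps ^ n * 1 \<le> 1 * eps ^ Suc k"
      using eps kn power_decreasing[of "Suc k" n eps] by simp
    also have "\<dots> \<le> K ^ n * eps ^ Suc k" using K eps by (intro mult_right_mono one_le_power) auto
    finally show ?thesis .
  qed
  hence "(\<Sum>b\<in>V - {p}. \<bar>E a b * X l b\<bar>) \<le> real (card (V - {p})) * (K ^ n * eps ^ Suc k)"
    by (rule sum_bounded_above)
  also have "\<dots> \<le> real n * (K ^ n * eps ^ Suc k)"
    using K eps V n card_Diff1_le[of V p] by (intro mult_right_mono) auto
  also have "\<dots> = (real n * K ^ n * eps) * eps ^ k" by simp
  also have "\<dots> \<le> (?c ^ n / 2) * eps ^ k" using small eps by (intro mult_right_mono) auto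
  also have "\<dots> \<le> (?c ^ k / 2) * eps ^ k"
    using c eps kn by (intro mult_right_mono divide_right_mono power_decreasing) auto
  finally have rest: "\<bar>\<Sum>b\<in>V - {p}. E a b * X l b\<bar> \<le> ?c ^ k * eps ^ k / 2"
    using sum_abs[of "\<lambda>b. E a b * X l b" "V - {p}"] by linarith
  have "(\<Sum>b\<in>V. E a b * X l b) = X l p + (\<Sum>b\<in>V - {p}. E a b * X l b)"
    using V t[OF p(1)] Et[OF p(1)] by (simp add: sum.remove[of V p])
  moreover have "?c ^ k * eps ^ k \<le> \<bar>X l p\<bar>"
    using Suc.IH[OF t[OF p(1)]] p(2) Suc.prems(2) by simp
  ultimately have "?c ^ k * eps ^ k / 2 \<le> \<bar>\<Sum>b\<in>V. E a b * X l b\<bar>" using rest by linarith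
  hence "eps * (?c ^ k * eps ^ k / 2) \<le> eps * \<bar>\<Sum>b\<in>V. E a b * X l b\<bar>"
    using eps by (intro mult_left_mono) auto
  also have "\<dots> \<le> \<bar>X l a\<bar> * L" by (rule eq[OF l Suc.prems(1) la])
  finally have "eps * (?c ^ k * eps ^ k / 2) / L \<le> \<bar>X l a\<bar>" using L by (simp add: divide_le_eq)
  moreover have "eps * (?c ^ k * eps ^ k / 2) / L = ?c ^ Suc k * eps ^ Suc k"
    by (simp add: field_simps)
  ultimately show ?case by linarith
qed

text \<open>
  Every off-diagonal entry of the eigenvector matrix is of the exact order \<^term>\<open>eps ^ D l a\<close>, since the
  unique path in the spanning tree dominates all other walks; in particular it does not vanish.
\<close>
lemma near_identity_eigenvectors:
  fixes lam :: "'a \<Rightarrow> real"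
  assumes G: "connected_graph G" and inj: "inj_on lam (verts G)" and delta: "delta > 0"
  shows "\<exists>A\<in>S_graph G. \<exists>X :: 'a \<Rightarrow> 'a \<Rightarrow> real.
     (\<forall>l\<in>verts G. \<forall>a\<in>verts G. (\<Sum>b\<in>verts G. A a b * X l b) = lam l * X l a)
     \<and> (\<forall>l\<in>verts G. X l l = 1)
     \<and> (\<forall>l\<in>verts G. \<forall>a\<in>verts G. X l a \<noteq> 0 \<and> (l \<noteq> a \<longrightarrow> \<bar>X l a\<bar> < delta))"
proof -
  let ?V = "verts G"
  have V: "finite ?V" "?V \<noteq> {}" and sg: "simple_graph G"
    using G unfolding connected_graph_def simple_graph_def by blast+
  obtain t D where T: "tree_metric ?V t D" and tG: "\<And>a b. t a b \<Longrightarrow> adj G a b"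
    using spanning_tree[OF G] by blast
  define n where "n = card ?V"
  have n: "n \<ge> 1" using V by (simp add: n_def Suc_le_eq card_gt_0_iff)
  have "\<exists>d>0. \<forall>i\<in>{(l, a). l \<in> ?V \<and> a \<in> ?V \<and> l \<noteq> a}. d < (\<lambda>(l, a). \<bar>lam l - lam a\<bar>) i"
  proof (rule finite_positive_lower_bound)
    show "finite {(l, a). l \<in> ?V \<and> a \<in> ?V \<and> l \<noteq> a}"
      by (rule finite_subset[of _ "?V \<times> ?V"]) (use V in auto)
  qed (use inj in \<open>auto dest: inj_onD\<close>)
  then obtain g0 where g0: "g0 > 0" "\<And>l a. l \<in> ?V \<Longrightarrow> a \<in> ?V \<Longrightarrow> l \<noteq> a \<Longrightarrow> g0 < \<bar>lam l - lam a\<bar>"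
    by auto
  define g where "g = min g0 1"
  have g: "0 < g" "g \<le> 1" and gap: "\<And>l a. l \<in> ?V \<Longrightarrow> a \<in> ?V \<Longrightarrow> l \<noteq> a \<Longrightarrow> g \<le> \<bar>lam l - lam a\<bar>"
    using g0(1) less_imp_le[OF g0(2)] by (auto simp: g_def min_le_iff_disj)
  define K where "K = 2 * real n / g"
  have "1 \<le> 2 * real n" using n by simp
  hence K: "K \<ge> 1" using g unfolding K_def by (simp add: le_divide_eq)
  define L where "L = 2 * (\<Sum>a\<in>?V. \<bar>lam a\<bar>) + 1"
  have L: "L \<ge> 1" by (simp add: L_def sum_nonneg)
  define c where "c = 1 / (2 * L)"
  have c: "c > 0" using L by (simp add: c_def)
  \<comment> \<open>The second bound makes the fixed point map a contraction, the third makes the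
    off-diagonal entries, at most \<open>K * eps\<close>, smaller than \<open>delta\<close>, and the
    fourth lets the tree path dominate.\<close>
  define eps where "eps = min (min 1 (g / (8 * real n))) (min (delta / (2 * K)) (c ^ n / (2 * (real n * K ^ n))))"
  have nK: "real n * K ^ n > 0" using n K by simp
  have eps0: "0 < eps" using g n delta K c nK unfolding eps_def by simp
  have eps1: "eps \<le> 1" by (simp add: eps_def)
  have "eps \<le> g / (8 * real n)" by (simp add: eps_def)
  hence eps2: "eps * real n \<le> g / 8" using n by (simp add: field_simps)
  have "eps \<le> delta / (2 * K)" by (simp add: eps_def)
  hence "K * eps \<le> delta / 2" using K by (simp add: field_simps)
  hence eps3: "K * eps < delta" using delta by linarith
  have "eps \<le> c ^ n / (2 * (real n * K ^ n))" by (simp add: eps_def)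
  hence "eps * (2 * (real n * K ^ n)) \<le> c ^ n" using nK by (simp add: pos_le_divide_eq)
  hence eps4: "real n * K ^ n * eps \<le> c ^ n / 2" by (simp add: mult_ac)
  define E where "E a b = (if t a b then 1 else if adj G a b then eps ^ n else 0)" for a b
  have E1: "\<bar>E a b\<bar> \<le> 1" for a b using eps0 eps1 by (auto simp: E_def power_le_one)
  have Ee: "\<bar>E a b\<bar> \<le> eps ^ n" if "\<not> t a b" for a b using that eps0 by (auto simp: E_def)
  have E0: "E a a = 0" for a
    using tG[of a a] sg unfolding E_def simple_graph_def by auto
  have "\<exists>(X :: 'a \<Rightarrow> 'a \<Rightarrow> real) d. (\<forall>l\<in>?V. X l l = 1) \<and> (\<forall>l\<in>?V. \<forall>a\<in>?V. \<bar>X l a\<bar> \<le> 1)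
      \<and> (\<forall>a\<in>?V. \<bar>d a - lam a\<bar> \<le> g / 8)
      \<and> (\<forall>l\<in>?V. \<forall>a\<in>?V. d a * X l a + eps * (\<Sum>b\<in>?V. E a b * X l b) = lam l * X l a)"
    by (rule perturbed_diagonal_eigenvectors[OF V(1) g(1) gap E1 E0])
       (use eps0 eps2 in \<open>auto simp: n_def\<close>)
  then obtain X d where X0: "\<forall>l\<in>?V. X l l = (1::real)" and X1: "\<forall>l\<in>?V. \<forall>a\<in>?V. \<bar>X l a\<bar> \<le> 1"
    and d: "\<forall>a\<in>?V. \<bar>d a - lam a\<bar> \<le> g / 8"
    and eq: "\<forall>l\<in>?V. \<forall>a\<in>?V. d a * X l a + eps * (\<Sum>b\<in>?V. E a b * X l b) = lam l * X l a"
    by (elim exE conjE)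
  have eqa: "eps * \<bar>\<Sum>b\<in>?V. E a b * X l b\<bar> = \<bar>X l a\<bar> * \<bar>lam l - d a\<bar>" if "l \<in> ?V" "a \<in> ?V" for l a
  proof -
    have "eps * (\<Sum>b\<in>?V. E a b * X l b) = X l a * (lam l - d a)"
      using eq that by (simp add: algebra_simps)
    hence "\<bar>eps * (\<Sum>b\<in>?V. E a b * X l b)\<bar> = \<bar>X l a * (lam l - d a)\<bar>" by simp
    thus ?thesis using eps0 by (simp add: abs_mult)
  qed
  have lower: "\<bar>X l a\<bar> * g / 2 \<le> eps * \<bar>\<Sum>b\<in>?V. E a b * X l b\<bar>" if la: "l \<in> ?V" "a \<in> ?V" "l \<noteq> a" for l a
  proof -
    have "\<bar>d a - lam a\<bar> \<le> g / 8" using d la by blast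
    hence "g / 2 \<le> \<bar>lam l - d a\<bar>" using gap[OF la] g by linarith
    thus ?thesis using mult_left_mono[of "g / 2" "\<bar>lam l - d a\<bar>" "\<bar>X l a\<bar>"] eqa la by simp
  qed
  have upper: "eps * \<bar>\<Sum>b\<in>?V. E a b * X l b\<bar> \<le> \<bar>X l a\<bar> * L" if la: "l \<in> ?V" "a \<in> ?V" "l \<noteq> a" for l a
  proof -
    have "\<bar>lam l\<bar> \<le> (\<Sum>a\<in>?V. \<bar>lam a\<bar>)" "\<bar>lam a\<bar> \<le> (\<Sum>a\<in>?V. \<bar>lam a\<bar>)"
      using la V by (auto intro!: member_le_sum)
    moreover have "\<bar>d a - lam a\<bar> \<le> g / 8" using d la by blast
    ultimately have "\<bar>lam l - d a\<bar> \<le> L" using g unfolding L_def by linarith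
    thus ?thesis using mult_left_mono[of "\<bar>lam l - d a\<bar>" L "\<bar>X l a\<bar>"] eqa la by simp
  qed
  have Xu: "\<bar>X l a\<bar> \<le> K ^ k * eps ^ k" if "l \<in> ?V" "a \<in> ?V" "k \<le> n" "k \<le> D l a" for l a k
    by (rule tree_weighted_eigenvectors_upper[where X = X and E = E and l = l, OF V(1) T n_def g K_def eps0 eps1 E1 Ee _ lower])
       (use X1 that in auto)
  have Xl: "(1 / (2 * L)) ^ k * eps ^ k \<le> \<bar>X l a\<bar>" if la: "l \<in> ?V" "a \<in> ?V" "D l a = k" for l a k
    by (rule tree_weighted_eigenvectors_lower[where X = X and E = E and l = l, OF V(1) T n_def K eps0 eps1 L eps4[unfolded c_def] _ Ee _ _ Xu[OF la(1)] upper])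
       (use X0 X1 la in \<open>auto simp: E_def\<close>)
  have nz: "X l a \<noteq> 0" if "l \<in> ?V" "a \<in> ?V" for l a
  proof -
    have "0 < c ^ D l a * eps ^ D l a" using c eps0 by simp
    thus ?thesis using Xl[OF that refl] unfolding c_def by auto
  qed
  have sm: "\<bar>X l a\<bar> < delta" if "l \<in> ?V" "a \<in> ?V" "l \<noteq> a" for l a
  proof -
    have "D l a \<ge> 1" using T that unfolding tree_metric_def by (metis One_nat_def Suc_leI zero_less_Suc)
    thus ?thesis using Xu[of l a 1] that n eps3 by simp
  qed
  define A where "A a b = (if a \<in> ?V \<and> b \<in> ?V then (if a = b then d a else eps * E a b) else 0)" for a b
  have tsym: "t a b \<longleftrightarrow> t b a" for a b using T unfolding tree_metric_def by blast
  have asym: "adj G a b \<longleftrightarrow> adj G b a" for a b using sg unfolding simple_graph_def by blast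
  have "A \<in> S_graph G"
    unfolding S_graph_def
  proof (intro CollectI conjI allI ballI impI)
    fix i j show "A i j = A j i" by (simp add: A_def E_def tsym[of i j] asym[of i j])
  next
    fix i j assume "i \<in> ?V" "j \<in> ?V" "i \<noteq> j"
    thus "(A i j \<noteq> 0) = adj G i j" using tG[of i j] eps0 by (simp add: A_def E_def)
  qed (auto simp: A_def)
  moreover have "(\<Sum>b\<in>?V. A a b * X l b) = lam l * X l a" if la: "l \<in> ?V" "a \<in> ?V" for l a
  proof -
    have "(\<Sum>b\<in>?V. A a b * X l b) = (\<Sum>b\<in>?V. (if a = b then d a * X l a else 0) + eps * (E a b * X l b))"
      using la by (intro sum.cong refl) (simp add: A_def E0)
    also have "\<dots> = d a * X l a + eps * (\<Sum>b\<in>?V. E a b * X l b)"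
      using V la by (simp add: sum.distrib sum_distrib_left)
    finally show ?thesis using eq la by simp
  qed
  ultimately show ?thesis using X0 nz sm by (intro bexI[of _ A] exI[of _ X] conjI ballI impI) auto
qed

section \<open>Joins of two connected graphs\<close>

lemma parseval_cong:
  fixes U :: "'i \<Rightarrow> 'a \<Rightarrow> real"
  assumes I: "finite I"
    and U: "\<And>l l'. l \<in> I \<Longrightarrow> l' \<in> I \<Longrightarrow> (\<Sum>x\<in>V. U l x * U l' x) = (if l = l' then 1 else 0)"
    and f: "\<And>x. x \<in> V \<Longrightarrow> f x = (\<Sum>l\<in>I. p l * U l x)"
    and g: "\<And>x. x \<in> V \<Longrightarrow> g x = (\<Sum>l\<in>I. q l * U l x)"
  shows "(\<Sum>x\<in>V. f x * g x) = (\<Sum>l\<in>I. p l * q l)"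
proof -
  have "(\<Sum>x\<in>V. f x * g x) = (\<Sum>x\<in>V. (\<Sum>l\<in>I. p l * U l x) * (\<Sum>l\<in>I. q l * U l x))"
    by (intro sum.cong refl) (simp add: f g)
  also have "\<dots> = (\<Sum>l\<in>I. p l * q l)" by (rule parseval[OF I U])
  finally show ?thesis .
qed

lemma S_graph_sym: "A \<in> S_graph G \<Longrightarrow> A i j = A j i"
  unfolding S_graph_def by blast

text \<open>Eigenvectors are numbered by \<open>{..<n}\<close> instead of by vertices so that the
  bases of two graphs can be paired term by term; \<open>\<phi>\<close> remembers the vertex near
  which each is concentrated.\<close>

lemma spectral_realization:
  fixes G :: "'a graph" and lam :: "nat \<Rightarrow> real"
  assumes G: "connected_graph G" and n: "n = card (verts G)"
    and inj: "inj_on lam {..<n}" and delta: "delta > 0"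
  shows "\<exists>A\<in>S_graph G. \<exists>(U :: nat \<Rightarrow> 'a \<Rightarrow> real) \<phi>. bij_betw \<phi> {..<n} (verts G)
     \<and> (\<forall>l<n. \<forall>l'<n. (\<Sum>x\<in>verts G. U l x * U l' x) = (if l = l' then 1 else 0))
     \<and> (\<forall>a\<in>verts G. \<forall>b\<in>verts G. A a b = (\<Sum>l<n. lam l * U l a * U l b))
     \<and> (\<forall>l<n. \<forall>a\<in>verts G. U l a \<noteq> 0)
     \<and> (\<forall>l<n. \<forall>l'<n. \<bar>U l (\<phi> l') - (if l = l' then 1 else 0)\<bar> < delta)"
proof -
  let ?V = "verts G"
  have V: "finite ?V" using G unfolding connected_graph_def simple_graph_def by blast
  obtain \<phi> where phi: "bij_betw \<phi> {..<n} ?V"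
    using ex_bij_betw_nat_finite[OF V] n by (auto simp: atLeast0LessThan)
  have pinj: "inj_on \<phi> {..<n}" and pV: "\<And>l. l < n \<Longrightarrow> \<phi> l \<in> ?V"
    using phi unfolding bij_betw_def by auto
  define psi where "psi = inv_into {..<n} \<phi>"
  have psi: "psi (\<phi> l) = l" if "l < n" for l using pinj that by (simp add: psi_def)
  have psiinj: "bij_betw psi ?V {..<n}" unfolding psi_def by (rule bij_betw_inv_into[OF phi])
  have inj': "inj_on (lam \<circ> psi) ?V"
    using psiinj inj unfolding bij_betw_def by (intro comp_inj_on) auto
  \<comment> \<open>Up to \<open>n\<close> squares of off-diagonal entries, each at most
    \<open>d\<close>, must add up to less than \<open>delta\<close>; then the squared norms lie
    between 1 and \<open>1 + delta\<close>.\<close>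
  define d where "d = min 1 (delta / (real n + 1))"
  have d: "d > 0" "d \<le> 1" using delta by (auto simp: d_def)
  have "d \<le> delta / (real n + 1)" by (simp add: d_def)
  hence "d * (real n + 1) \<le> delta" by (simp add: pos_le_divide_eq)
  hence "d * real n + d \<le> delta" by (simp add: distrib_left)
  moreover have "0 \<le> d * real n" using d by simp
  ultimately have dn: "real n * d < delta" "d \<le> delta"
    using d unfolding mult.commute[of "real n"] by linarith+
  obtain A X where A: "A \<in> S_graph G"
    and eig: "\<forall>l\<in>?V. \<forall>a\<in>?V. (\<Sum>b\<in>?V. A a b * X l b) = (lam \<circ> psi) l * X l a"
    and X0: "\<forall>l\<in>?V. X l l = (1::real)"
    and X: "\<forall>l\<in>?V. \<forall>a\<in>?V. X l a \<noteq> 0 \<and> (l \<noteq> a \<longrightarrow> \<bar>X l a\<bar> < d)"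
    using near_identity_eigenvectors[OF G inj' d(1)] by (elim bexE exE conjE)
  have Xnz: "X l a \<noteq> 0" if "l \<in> ?V" "a \<in> ?V" for l a
    using bspec[OF bspec[OF X that(1)] that(2)] by simp
  have Xd: "\<bar>X l a\<bar> < d" if "l \<in> ?V" "a \<in> ?V" "l \<noteq> a" for l a
    using bspec[OF bspec[OF X that(1)] that(2)] that(3) by simp
  define N where "N l = (\<Sum>b\<in>?V. X (\<phi> l) b * X (\<phi> l) b)" for l
  have N: "1 \<le> N l" "N l < 1 + delta" if l: "l < n" for l
  proof -
    have eq: "N l = 1 + (\<Sum>b\<in>?V - {\<phi> l}. X (\<phi> l) b * X (\<phi> l) b)"
      unfolding N_def using V pV[OF l] X0 by (simp add: sum.remove[of ?V "\<phi> l"])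
    have "X (\<phi> l) b * X (\<phi> l) b \<le> d" if "b \<in> ?V - {\<phi> l}" for b
    proof -
      have "\<bar>X (\<phi> l) b\<bar> < d" using that by (intro Xd pV[OF l]) auto
      hence "\<bar>X (\<phi> l) b\<bar> * \<bar>X (\<phi> l) b\<bar> \<le> d * 1" using d by (intro mult_mono) auto
      thus ?thesis by simp
    qed
    hence "(\<Sum>b\<in>?V - {\<phi> l}. X (\<phi> l) b * X (\<phi> l) b) \<le> real (card (?V - {\<phi> l})) * d"
      by (rule sum_bounded_above)
    also have "\<dots> \<le> real n * d"
      using d V n card_Diff1_le[of ?V "\<phi> l"] by (intro mult_right_mono) auto
    finally show "N l < 1 + delta" using eq dn by linarith
    show "1 \<le> N l" unfolding eq by (simp add: sum_nonneg)
  qed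
  define U where "U l a = X (\<phi> l) a / sqrt (N l)" for l a
  have s1: "1 \<le> sqrt (N l)" if "l < n" for l using N[OF that] by simp
  have orth: "(\<Sum>x\<in>?V. U l x * U l' x) = (if l = l' then 1 else 0)" if l: "l < n" "l' < n" for l l'
  proof -
    have "(\<Sum>x\<in>?V. U l x * U l' x) = (\<Sum>x\<in>?V. X (\<phi> l) x * X (\<phi> l') x) / (sqrt (N l) * sqrt (N l'))"
      by (simp add: U_def sum_divide_distrib)
    also have "(\<Sum>x\<in>?V. X (\<phi> l) x * X (\<phi> l') x) = (if l = l' then N l else 0)"
    proof (cases "l = l'")
      case True thus ?thesis by (simp add: N_def)
    next
      case False
      have ne: "(lam \<circ> psi) (\<phi> l) \<noteq> (lam \<circ> psi) (\<phi> l')"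
        using False inj l psi by (auto dest: inj_onD)
      have "(\<Sum>x\<in>?V. X (\<phi> l) x * X (\<phi> l') x) = 0"
        by (rule eigenvectors_orthogonal[OF S_graph_sym[OF A] _ _ ne])
           (rule bspec[OF bspec[OF eig]], rule pV, rule l, assumption)+
      thus ?thesis using False by simp
    qed
    finally show ?thesis using N[OF l(1)] N[OF l(2)] by simp
  qed
  have orthn: "(\<Sum>x\<in>?V. U l x * U l' x) = (if l = l' then 1 else 0)"
    if "l \<in> {..<n}" "l' \<in> {..<n}" for l l' using orth that by simp
  have compl: "(\<Sum>l<n. U l a * U l b) = (if a = b then 1 else 0)" if "a \<in> ?V" "b \<in> ?V" for a b
    by (rule orthonormal_complete[OF V _ _ orthn that]) (simp_all add: n)
  have spec: "A a b = (\<Sum>l<n. lam l * U l a * U l b)" if ab: "a \<in> ?V" "b \<in> ?V" for a b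
  proof -
    have "lam l * U l a = (\<Sum>x\<in>?V. A a x * U l x)" if l: "l < n" for l
    proof -
      have "(\<Sum>x\<in>?V. A a x * X (\<phi> l) x) = lam l * X (\<phi> l) a"
        using eig pV[OF l] ab(1) psi[OF l] by simp
      moreover have "(\<Sum>x\<in>?V. A a x * U l x) = (\<Sum>x\<in>?V. A a x * X (\<phi> l) x) / sqrt (N l)"
        by (simp add: U_def sum_divide_distrib)
      ultimately show ?thesis by (simp add: U_def)
    qed
    hence "(\<Sum>l<n. lam l * U l a * U l b) = (\<Sum>l<n. \<Sum>x\<in>?V. A a x * (U l x * U l b))"
      by (intro sum.cong refl) (simp add: sum_distrib_right mult.assoc)
    also have "\<dots> = (\<Sum>x\<in>?V. A a x * (\<Sum>l<n. U l x * U l b))"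
      by (subst sum.swap) (simp add: sum_distrib_left)
    also have "\<dots> = (\<Sum>x\<in>?V. if x = b then A a x else 0)"
      by (intro sum.cong refl) (simp add: compl ab(2))
    also have "\<dots> = A a b" using V ab by simp
    finally show ?thesis by simp
  qed
  have nz: "U l a \<noteq> 0" if l: "l < n" "a \<in> ?V" for l a
  proof -
    have "X (\<phi> l) a \<noteq> 0" by (rule Xnz[OF pV[OF l(1)] l(2)])
    thus ?thesis using s1[OF l(1)] by (simp add: U_def)
  qed
  have close: "\<bar>U l (\<phi> l') - (if l = l' then 1 else 0)\<bar> < delta" if l: "l < n" "l' < n" for l l'
  proof (cases "l = l'")
    case True
    let ?s = "sqrt (N l)"
    have s: "1 \<le> ?s" using s1 l by simp
    have "?s * 1 \<le> ?s * ?s" using s by (intro mult_left_mono) auto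
    hence "?s < 1 + delta" using N[OF l(1)] by simp
    moreover have "1 - 1 / ?s \<le> ?s - 1"
    proof -
      have "1 - 1 / ?s = (?s - 1) / ?s" using s by (simp add: diff_divide_distrib)
      also have "\<dots> \<le> (?s - 1) / 1" using s by (intro divide_left_mono) auto
      finally show ?thesis by simp
    qed
    moreover have "1 / ?s \<le> 1" using s by simp
    moreover have "U l (\<phi> l') = 1 / ?s" using X0 pV[OF l(1)] True by (simp add: U_def)
    ultimately show ?thesis using True by simp
  next
    case False
    hence "\<phi> l \<noteq> \<phi> l'" using pinj l by (auto dest: inj_onD)
    hence "\<bar>X (\<phi> l) (\<phi> l')\<bar> < d" by (intro Xd pV l)
    moreover have "\<bar>X (\<phi> l) (\<phi> l')\<bar> / sqrt (N l) \<le> \<bar>X (\<phi> l) (\<phi> l')\<bar> / 1"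
      using s1[OF l(1)] by (intro divide_left_mono) auto
    moreover have "\<bar>U l (\<phi> l')\<bar> = \<bar>X (\<phi> l) (\<phi> l')\<bar> / sqrt (N l)"
      using s1[OF l(1)] by (simp add: U_def)
    ultimately show ?thesis using False dn(2) by simp
  qed
  show ?thesis
    by (rule bexI[OF _ A], intro exI[of _ U] exI[of _ \<phi>] conjI allI ballI impI phi)
       (use orth spec nz close in auto)
qed

section \<open>Block data for one pair of components\<close>

text \<open>
  A symmetric orthogonal matrix whose diagonal blocks are \<^term>\<open>A\<close> and \<^term>\<open>C\<close> and whose
  off-diagonal block is \<open>u v\<^sup>T + R\<close>, with \<^term>\<open>u\<close> and \<^term>\<open>v\<close> in the kernels of \<^term>\<open>A\<close> and
  \<^term>\<open>C\<close>. Only the kernel part \<open>u v\<^sup>T\<close> is coupled to the other components of the join; there it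
  is rescaled to \<open>w u v\<^sup>T\<close>, and the last condition concerns the rescaled block.
\<close>
definition join_data :: "real \<Rightarrow> 'a graph \<Rightarrow> 'b graph \<Rightarrow> ('a \<Rightarrow> 'a \<Rightarrow> real) \<Rightarrow> ('b \<Rightarrow> 'b \<Rightarrow> real)
    \<Rightarrow> ('a \<Rightarrow> 'b \<Rightarrow> real) \<Rightarrow> ('a \<Rightarrow> real) \<Rightarrow> ('b \<Rightarrow> real) \<Rightarrow> bool" where
  "join_data w G H A C R u v \<longleftrightarrow> A \<in> S_graph G \<and> C \<in> S_graph H
     \<and> (\<forall>a\<in>verts G. \<forall>a'\<in>verts G. (\<Sum>x\<in>verts G. A a x * A x a') + (\<Sum>b\<in>verts H. R a b * R a' b)
          + u a * u a' = (if a = a' then 1 else 0))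
     \<and> (\<forall>b\<in>verts H. \<forall>b'\<in>verts H. (\<Sum>y\<in>verts H. C b y * C y b') + (\<Sum>a\<in>verts G. R a b * R a b')
          + v b * v b' = (if b = b' then 1 else 0))
     \<and> (\<forall>a\<in>verts G. \<forall>b\<in>verts H. (\<Sum>x\<in>verts G. A a x * R x b) + (\<Sum>y\<in>verts H. R a y * C y b) = 0)
     \<and> (\<forall>a\<in>verts G. (\<Sum>x\<in>verts G. A a x * u x) = 0)
     \<and> (\<forall>b\<in>verts H. (\<Sum>y\<in>verts H. C b y * v y) = 0)
     \<and> (\<forall>a\<in>verts G. (\<Sum>b\<in>verts H. R a b * v b) = 0)
     \<and> (\<forall>b\<in>verts H. (\<Sum>a\<in>verts G. R a b * u a) = 0)
     \<and> (\<Sum>a\<in>verts G. u a * u a) = 1 \<and> (\<Sum>b\<in>verts H. v b * v b) = 1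
     \<and> (\<forall>a\<in>verts G. u a \<noteq> 0) \<and> (\<forall>b\<in>verts H. v b \<noteq> 0)
     \<and> (\<forall>a\<in>verts G. \<forall>b\<in>verts H. w * (u a * v b) + R a b \<noteq> 0)"

definition joinable :: "real \<Rightarrow> 'a graph \<Rightarrow> 'b graph \<Rightarrow> bool" where
  "joinable w G H \<longleftrightarrow> (\<exists>A C R u v. join_data w G H A C R u v)"

lemma joinable_swap:
  assumes "joinable w G H"
  shows "joinable w H G"
proof -
  obtain A C R u v where J: "join_data w G H A C R u v" using assms unfolding joinable_def by blast
  have A: "A i j = A j i" and C: "C k l = C l k" for i j k l
    using J unfolding join_data_def by (blast intro: S_graph_sym)+
  have "(\<Sum>x\<in>verts H. C b x * R a x) + (\<Sum>y\<in>verts G. R y b * A y a) = 0"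
    if "a \<in> verts G" "b \<in> verts H" for a b
  proof -
    have "(\<Sum>x\<in>verts H. C b x * R a x) + (\<Sum>y\<in>verts G. R y b * A y a)
        = (\<Sum>x\<in>verts G. A a x * R x b) + (\<Sum>y\<in>verts H. R a y * C y b)"
      by (simp add: A[of _ a] C[of b] mult.commute)
    thus ?thesis using J that unfolding join_data_def by simp
  qed
  moreover have "w * (v b * u a) + R a b \<noteq> 0" if "a \<in> verts G" "b \<in> verts H" for a b
    using J that unfolding join_data_def by (simp add: mult.commute)
  ultimately have "join_data w H G C A (\<lambda>b a. R a b) v u"
    using J unfolding join_data_def by simp
  thus ?thesis unfolding joinable_def by blast
qed

text \<open>In the two eigenbases the rescaled block is a sum of terms
  \<open>z l * U l a * V l b\<close> with nonzero \<open>z l\<close>. The basis \<open>U\<close> is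
  fixed first and need only be nowhere zero; \<open>V\<close> then comes so close to unit vectors
  that at the vertex \<open>\<psi> i\<close> the term with \<open>l = i\<close> outweighs the
  rest.\<close>

lemma joinable_if_card_le:
  fixes G :: "'a graph" and H :: "'b graph"
  assumes G: "connected_graph G" and H: "connected_graph H" and w: "w \<noteq> 0"
    and le: "card (verts H) \<le> card (verts G)" "card (verts G) \<le> card (verts H) + 2"
  shows "joinable w G H"
proof -
  define n m where "n = card (verts G)" and "m = card (verts H)"
  have fin: "finite (verts G)" "finite (verts H)"
    using G H unfolding connected_graph_def simple_graph_def by blast+
  have m: "m \<ge> 1" using H fin unfolding m_def connected_graph_def
    by (simp add: Suc_le_eq card_gt_0_iff)
  have mn: "m \<le> n" "n \<le> m + 2" using le by (simp_all add: n_def m_def)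
  have n0: "0 < n" and m0: "0 < m" using m mn by auto
  \<comment> \<open>The values below index \<open>m\<close> are shared with \<open>H\<close> up to
    sign, starting with the kernel value 0. As \<open>n \<le> m + 2\<close>, at most the indices
    \<open>m\<close> and \<open>Suc m\<close> remain; their eigenvalues 1 and -1 need no
    partner.\<close>
  define lam where "lam l = (if l < m then real l / real (m + 1) else if l = m then 1 else - 1)" for l
  have lam1: "0 \<le> lam l" "lam l < 1" if "l < m" for l using that by (auto simp: lam_def)
  have lam0: "lam 0 = 0" using m by (simp add: lam_def)
  have inj: "inj_on lam {..<n}"
  proof (rule inj_onI)
    fix x y assume xy: "x \<in> {..<n}" "y \<in> {..<n}" "lam x = lam y"
    have c: "z < m \<or> z = m \<or> z = Suc m" if "z \<in> {..<n}" for z using that mn by auto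
    have e: "lam m = 1" "lam (Suc m) = - 1" by (simp_all add: lam_def)
    show "x = y"
    proof (cases "x < m \<and> y < m")
      case True thus ?thesis using xy(3) by (simp add: lam_def)
    next
      case False
      thus ?thesis using c[OF xy(1)] c[OF xy(2)] xy(3) e lam1[of x] lam1[of y] by auto
    qed
  qed
  have inj': "inj_on (\<lambda>l. - lam l) {..<m}"
    using inj mn unfolding inj_on_def by simp
  \<comment> \<open>The coefficients of \<open>R\<close>. They vanish at 0, where the kernel term
    \<open>e\<close> takes over, and from \<open>m\<close> on, so sums over the shorter basis may be
    read over the longer one. The square identities of \<open>join_data\<close> then hold
    coefficient by coefficient through \<open>norm1\<close>.\<close>
  define r where "r l = (if l = 0 \<or> m \<le> l then 0 else sqrt (1 - (lam l)\<^sup>2))" for l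
  define e where "e l = (if l = 0 then 1 else 0 :: real)" for l :: nat
  have norm1: "lam l * lam l + r l * r l + e l = 1" if "l < n" for l
  proof (cases "l = 0 \<or> m \<le> l")
    case True
    thus ?thesis using lam0 m that mn by (auto simp: r_def e_def lam_def)
  next
    case False
    have "(lam l)\<^sup>2 \<le> 1" using lam1[of l] False by (simp add: abs_square_le_1)
    thus ?thesis using False by (simp add: r_def e_def power2_eq_square)
  qed
  define z where "z l = (if l = 0 then w else r l)" for l
  have z: "z l \<noteq> 0" if "l < m" for l
  proof (cases "l = 0")
    case False
    have "lam l * lam l \<le> lam l * 1" using lam1[OF that] by (intro mult_left_mono) auto
    hence "lam l * lam l < 1" using lam1[OF that] by simp
    thus ?thesis using False that by (simp add: z_def r_def power2_eq_square)
  qed (simp add: z_def w)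
  obtain A U \<phi> where A: "A \<in> S_graph G"
    and U: "\<forall>l<n. \<forall>l'<n. (\<Sum>x\<in>verts G. U l x * U l' x) = (if l = l' then 1 else 0 :: real)"
    and AU: "\<forall>a\<in>verts G. \<forall>b\<in>verts G. A a b = (\<Sum>l<n. lam l * U l a * U l b)"
    and Unz: "\<forall>l<n. \<forall>a\<in>verts G. U l a \<noteq> 0"
    using spectral_realization[OF G n_def inj zero_less_one] by (elim bexE exE conjE)
  \<comment> \<open>Entries of \<open>V\<close> within \<open>d\<close> of unit vectors give an
    error of at most \<open>d\<close> times the sum over \<open>h\<close>, which must stay below the
    dominant term. The added 1 only keeps the denominator positive.\<close>
  have "\<exists>d>0. \<forall>i\<in>verts G \<times> {..<m}. d < (\<lambda>(a, i). \<bar>z i * U i a\<bar> / (1 + (\<Sum>h<m. \<bar>z h * U h a\<bar>))) i"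
  proof (rule finite_positive_lower_bound)
    fix i assume "i \<in> verts G \<times> {..<m}"
    then obtain a j where i: "i = (a, j)" "a \<in> verts G" "j < m" by auto
    have "U j a \<noteq> 0" using Unz i mn by simp
    hence "\<bar>z j * U j a\<bar> > 0" using z[OF i(3)] by simp
    moreover have "1 + (\<Sum>h<m. \<bar>z h * U h a\<bar>) > 0"
      by (intro add_pos_nonneg sum_nonneg) auto
    ultimately show "0 < (\<lambda>(a, i). \<bar>z i * U i a\<bar> / (1 + (\<Sum>h<m. \<bar>z h * U h a\<bar>))) i"
      unfolding i(1) split_conv by (rule divide_pos_pos)
  qed (use fin in simp)
  then obtain d where d: "d > 0"
    and dless: "\<And>a i. a \<in> verts G \<Longrightarrow> i < m \<Longrightarrow> d < \<bar>z i * U i a\<bar> / (1 + (\<Sum>h<m. \<bar>z h * U h a\<bar>))"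
    by fastforce
  obtain C V \<psi> where C: "C \<in> S_graph H" and psi: "bij_betw \<psi> {..<m} (verts H)"
    and V: "\<forall>l<m. \<forall>l'<m. (\<Sum>x\<in>verts H. V l x * V l' x) = (if l = l' then 1 else 0 :: real)"
    and CV: "\<forall>a\<in>verts H. \<forall>b\<in>verts H. C a b = (\<Sum>l<m. - lam l * V l a * V l b)"
    and Vnz: "\<forall>l<m. \<forall>a\<in>verts H. V l a \<noteq> 0"
    and Vd: "\<forall>l<m. \<forall>l'<m. \<bar>V l (\<psi> l') - (if l = l' then 1 else 0)\<bar> < d"
    using spectral_realization[OF H m_def inj' d] by (elim bexE exE conjE)
  define R where "R a b = (\<Sum>l<m. r l * U l a * V l b)" for a b
  have U': "(\<Sum>x\<in>verts G. U l x * U l' x) = (if l = l' then 1 else 0)"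
    if "l \<in> {..<n}" "l' \<in> {..<n}" for l l' using U that by simp
  have V': "(\<Sum>x\<in>verts H. V l x * V l' x) = (if l = l' then 1 else 0)"
    if "l \<in> {..<m}" "l' \<in> {..<m}" for l l' using V that by simp
  have Uc: "(\<Sum>l<n. U l a * U l b) = (if a = b then 1 else 0)" if "a \<in> verts G" "b \<in> verts G" for a b
    by (rule orthonormal_complete[OF fin(1) _ _ U' that]) (simp_all add: n_def)
  have Vc: "(\<Sum>l<m. V l a * V l b) = (if a = b then 1 else 0)" if "a \<in> verts H" "b \<in> verts H" for a b
    by (rule orthonormal_complete[OF fin(2) _ _ V' that]) (simp_all add: m_def)
  have ext: "(\<Sum>l<m. f l) = (\<Sum>l<n. f l)" if "\<And>l. m \<le> l \<Longrightarrow> f l = 0" for f :: "nat \<Rightarrow> real"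
    by (rule sum.mono_neutral_left) (use mn that in auto)
  have Rb: "R a b = (\<Sum>l<m. (r l * U l a) * V l b)" for a b by (simp add: R_def)
  have Ra: "R a b = (\<Sum>l<n. (r l * V l b) * U l a)" for a b
    unfolding R_def by (subst ext) (auto simp: r_def mult_ac)
  have Aa: "A a x = (\<Sum>l<n. (lam l * U l a) * U l x)" if "a \<in> verts G" "x \<in> verts G" for a x
    using AU that by simp
  have Ca: "C a x = (\<Sum>l<m. (- lam l * V l a) * V l x)" if "a \<in> verts H" "x \<in> verts H" for a x
    using CV that by simp
  have se: "(\<Sum>l<k. e l * f l) = f 0" if "0 < k" for k :: nat and f :: "nat \<Rightarrow> real"
  proof -
    have "(\<Sum>l<k. e l * f l) = (\<Sum>l<k. if l = 0 then f 0 else 0)"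
      by (intro sum.cong refl) (auto simp: e_def)
    thus ?thesis using that by simp
  qed
  have u0: "U 0 x = (\<Sum>l<n. e l * U l x)" for x by (rule se[OF n0, symmetric])
  have v0: "V 0 x = (\<Sum>l<m. e l * V l x)" for x by (rule se[OF m0, symmetric])
  have pG: "(\<Sum>x\<in>verts G. f x * g x) = (\<Sum>l<n. p l * q l)"
    if "\<And>x. x \<in> verts G \<Longrightarrow> f x = (\<Sum>l<n. p l * U l x)"
       "\<And>x. x \<in> verts G \<Longrightarrow> g x = (\<Sum>l<n. q l * U l x)" for f g p q
    by (rule parseval_cong[OF finite_lessThan U' that])
  have pH: "(\<Sum>x\<in>verts H. f x * g x) = (\<Sum>l<m. p l * q l)"
    if "\<And>x. x \<in> verts H \<Longrightarrow> f x = (\<Sum>l<m. p l * V l x)"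
       "\<And>x. x \<in> verts H \<Longrightarrow> g x = (\<Sum>l<m. q l * V l x)" for f g p q
    by (rule parseval_cong[OF finite_lessThan V' that])
  have 1: "(\<Sum>x\<in>verts G. A a x * A x a') + (\<Sum>b\<in>verts H. R a b * R a' b) + U 0 a * U 0 a'
      = (if a = a' then 1 else 0)" if a: "a \<in> verts G" "a' \<in> verts G" for a a'
  proof -
    have "(\<Sum>x\<in>verts G. A a x * A x a') = (\<Sum>x\<in>verts G. A a x * A a' x)"
      by (simp add: S_graph_sym[OF A, of _ a'])
    also have "\<dots> = (\<Sum>l<n. (lam l * U l a) * (lam l * U l a'))"
      by (rule pG) (rule Aa[OF a(1)], assumption, rule Aa[OF a(2)], assumption)
    finally have i: "(\<Sum>x\<in>verts G. A a x * A x a') = (\<Sum>l<n. lam l * lam l * (U l a * U l a'))"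
      by (simp add: mult_ac)
    have "(\<Sum>b\<in>verts H. R a b * R a' b) = (\<Sum>l<m. (r l * U l a) * (r l * U l a'))"
      by (rule pH) (rule Rb)+
    also have "\<dots> = (\<Sum>l<n. r l * r l * (U l a * U l a'))"
      by (subst ext) (auto simp: r_def mult_ac)
    finally have ii: "(\<Sum>b\<in>verts H. R a b * R a' b) = (\<Sum>l<n. r l * r l * (U l a * U l a'))" .
    have iii: "U 0 a * U 0 a' = (\<Sum>l<n. e l * (U l a * U l a'))"
      by (rule se[OF n0, symmetric])
    have "(\<Sum>x\<in>verts G. A a x * A x a') + (\<Sum>b\<in>verts H. R a b * R a' b) + U 0 a * U 0 a'
        = (\<Sum>l<n. (lam l * lam l + r l * r l + e l) * (U l a * U l a'))"
      unfolding i ii iii by (simp only: distrib_right sum.distrib)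
    also have "\<dots> = (\<Sum>l<n. U l a * U l a')" by (intro sum.cong refl) (simp add: norm1)
    finally show ?thesis using Uc[OF a] by simp
  qed
  have 2: "(\<Sum>y\<in>verts H. C b y * C y b') + (\<Sum>a\<in>verts G. R a b * R a b') + V 0 b * V 0 b'
      = (if b = b' then 1 else 0)" if b: "b \<in> verts H" "b' \<in> verts H" for b b'
  proof -
    have "(\<Sum>y\<in>verts H. C b y * C y b') = (\<Sum>y\<in>verts H. C b y * C b' y)"
      by (simp add: S_graph_sym[OF C, of _ b'])
    also have "\<dots> = (\<Sum>l<m. (- lam l * V l b) * (- lam l * V l b'))"
      by (rule pH) (rule Ca[OF b(1)], assumption, rule Ca[OF b(2)], assumption)
    finally have i: "(\<Sum>y\<in>verts H. C b y * C y b') = (\<Sum>l<m. lam l * lam l * (V l b * V l b'))"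
      by (simp add: mult_ac)
    have "(\<Sum>a\<in>verts G. R a b * R a b') = (\<Sum>l<n. (r l * V l b) * (r l * V l b'))"
      by (rule pG) (rule Ra)+
    also have "\<dots> = (\<Sum>l<m. r l * r l * (V l b * V l b'))"
      by (subst ext) (auto simp: r_def mult_ac)
    finally have ii: "(\<Sum>a\<in>verts G. R a b * R a b') = (\<Sum>l<m. r l * r l * (V l b * V l b'))" .
    have iii: "V 0 b * V 0 b' = (\<Sum>l<m. e l * (V l b * V l b'))"
      by (rule se[OF m0, symmetric])
    have "(\<Sum>y\<in>verts H. C b y * C y b') + (\<Sum>a\<in>verts G. R a b * R a b') + V 0 b * V 0 b'
        = (\<Sum>l<m. (lam l * lam l + r l * r l + e l) * (V l b * V l b'))"
      unfolding i ii iii by (simp only: distrib_right sum.distrib)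
    also have "\<dots> = (\<Sum>l<m. V l b * V l b')" using mn by (intro sum.cong refl) (simp add: norm1)
    finally show ?thesis using Vc[OF b] by simp
  qed
  have 3: "(\<Sum>x\<in>verts G. A a x * R x b) + (\<Sum>y\<in>verts H. R a y * C y b) = 0"
    if ab: "a \<in> verts G" "b \<in> verts H" for a b
  proof -
    have "(\<Sum>x\<in>verts G. A a x * R x b) = (\<Sum>l<n. (lam l * U l a) * (r l * V l b))"
      by (rule pG) (rule Aa[OF ab(1)], assumption, rule Ra)
    also have "\<dots> = (\<Sum>l<m. (lam l * U l a) * (r l * V l b))"
      by (subst ext) (auto simp: r_def)
    finally have i: "(\<Sum>x\<in>verts G. A a x * R x b) = (\<Sum>l<m. (lam l * U l a) * (r l * V l b))" .
    have "(\<Sum>y\<in>verts H. R a y * C y b) = (\<Sum>y\<in>verts H. R a y * C b y)"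
      by (simp add: S_graph_sym[OF C, of _ b])
    also have "\<dots> = (\<Sum>l<m. (r l * U l a) * (- lam l * V l b))"
      by (rule pH) (rule Rb, rule Ca[OF ab(2)], assumption)
    also have "\<dots> = - (\<Sum>l<m. (lam l * U l a) * (r l * V l b))"
      unfolding sum_negf[symmetric] by (intro sum.cong refl) (simp add: mult_ac)
    finally show ?thesis using i by simp
  qed
  have 4: "(\<Sum>x\<in>verts G. A a x * U 0 x) = 0" if a: "a \<in> verts G" for a
  proof -
    have "(\<Sum>x\<in>verts G. A a x * U 0 x) = (\<Sum>l<n. (lam l * U l a) * e l)"
      by (rule pG) (rule Aa[OF a], assumption, rule u0)
    also have "\<dots> = 0" by (intro sum.neutral) (simp add: e_def lam0)
    finally show ?thesis .
  qed
  have 5: "(\<Sum>y\<in>verts H. C b y * V 0 y) = 0" if b: "b \<in> verts H" for b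
  proof -
    have "(\<Sum>x\<in>verts H. C b x * V 0 x) = (\<Sum>l<m. (- lam l * V l b) * e l)"
      by (rule pH) (rule Ca[OF b], assumption, rule v0)
    also have "\<dots> = 0" by (intro sum.neutral) (simp add: e_def lam0)
    finally show ?thesis .
  qed
  have 6: "(\<Sum>b\<in>verts H. R a b * V 0 b) = 0" for a
  proof -
    have "(\<Sum>b\<in>verts H. R a b * V 0 b) = (\<Sum>l<m. (r l * U l a) * e l)"
      by (rule pH) (rule Rb, rule v0)
    also have "\<dots> = 0" by (intro sum.neutral) (simp add: e_def r_def)
    finally show ?thesis .
  qed
  have 7: "(\<Sum>a\<in>verts G. R a b * U 0 a) = 0" for b
  proof -
    have "(\<Sum>a\<in>verts G. R a b * U 0 a) = (\<Sum>l<n. (r l * V l b) * e l)"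
      by (rule pG) (rule Ra, rule u0)
    also have "\<dots> = 0" by (intro sum.neutral) (simp add: e_def r_def)
    finally show ?thesis .
  qed
  have 8: "w * (U 0 a * V 0 b) + R a b \<noteq> 0" if ab: "a \<in> verts G" "b \<in> verts H" for a b
  proof -
    obtain i where i: "i < m" "b = \<psi> i" using psi ab(2) unfolding bij_betw_def by auto
    define c where "c l = z l * U l a" for l
    have "w * (U 0 a * V 0 b) + R a b = (\<Sum>l<m. (if l = 0 then w * (U 0 a * V 0 b) else 0) + r l * U l a * V l b)"
      using m0 by (simp add: R_def sum.distrib)
    also have "\<dots> = (\<Sum>l<m. c l * V l b)"
      by (intro sum.cong refl) (auto simp: c_def z_def r_def)
    also have "\<dots> = (\<Sum>l<m. (if l = i then c l else 0) + c l * (V l b - (if l = i then 1 else 0)))"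
      by (intro sum.cong refl) (auto simp: algebra_simps)
    also have "\<dots> = c i + (\<Sum>l<m. c l * (V l b - (if l = i then 1 else 0)))"
      using i by (simp add: sum.distrib)
    finally have eq: "w * (U 0 a * V 0 b) + R a b = c i + (\<Sum>l<m. c l * (V l b - (if l = i then 1 else 0)))" .
    have "\<bar>\<Sum>l<m. c l * (V l b - (if l = i then 1 else 0))\<bar> \<le> (\<Sum>l<m. \<bar>c l\<bar> * d)"
    proof (rule order_trans[OF sum_abs], rule sum_mono)
      fix l assume "l \<in> {..<m}"
      hence "\<bar>V l b - (if l = i then 1 else 0)\<bar> \<le> d" using Vd i by (simp add: less_imp_le)
      thus "\<bar>c l * (V l b - (if l = i then 1 else 0))\<bar> \<le> \<bar>c l\<bar> * d"
        unfolding abs_mult by (rule mult_left_mono) simp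
    qed
    also have "\<dots> = d * (\<Sum>l<m. \<bar>c l\<bar>)" by (simp add: sum_distrib_left mult.commute)
    finally have le: "\<bar>\<Sum>l<m. c l * (V l b - (if l = i then 1 else 0))\<bar> \<le> d * (\<Sum>l<m. \<bar>c l\<bar>)" .
    have "1 + (\<Sum>h<m. \<bar>c h\<bar>) > 0" by (intro add_pos_nonneg sum_nonneg) auto
    hence "d * (1 + (\<Sum>h<m. \<bar>c h\<bar>)) < \<bar>c i\<bar>"
      using dless[OF ab(1) i(1)] unfolding c_def by (simp add: pos_less_divide_eq)
    hence "d * (\<Sum>l<m. \<bar>c l\<bar>) < \<bar>c i\<bar>" using d by (simp add: distrib_left)
    thus ?thesis using eq le by linarith
  qed
  have "join_data w G H A C R (U 0) (V 0)"
    unfolding join_data_def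
    using A C 1 2 3 4 5 6 7 8 U V Unz Vnz n0 m0 by simp
  thus ?thesis unfolding joinable_def by blast
qed

lemma joinable_if_card_close:
  assumes "connected_graph G" "connected_graph H" "w \<noteq> 0"
    and "card (verts G) \<le> card (verts H) + 2" "card (verts H) \<le> card (verts G) + 2"
  shows "joinable w G H"
  using assms joinable_if_card_le[of G H w] joinable_if_card_le[of H G w] joinable_swap[of w H G]
  by (cases "card (verts H) \<le> card (verts G)") auto

section \<open>Complete graphs\<close>

text \<open>Let S copy the last coordinate of a vector into two, each with factor 1/sqrt 2, so that
  S^T S = 1. Then A' = 1 - S (1 - A) S^T satisfies A' S = S A and is the identity on the complement
  of the range of S. With R' = S R and u' = S u all identities carry over.\<close>

lemma joinable_complete_graph_Suc:
  fixes H :: "'b graph"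
  assumes J: "joinable w (complete_graph (Suc k)) H"
  shows "joinable w (complete_graph (Suc (Suc k))) H"
proof -
  note sum.lessThan_Suc [simp del]
  let ?K = "complete_graph (Suc k)" and ?L = "complete_graph (Suc (Suc k))"
  have vK: "verts ?K = {..<Suc k}" and vL: "verts ?L = {..<Suc (Suc k)}"
    by (simp_all add: complete_graph_def verts_def)
  obtain A C R u v where J: "join_data w ?K H A C R u v" using J unfolding joinable_def by blast
  have A: "A \<in> S_graph ?K" and C: "C \<in> S_graph H"
    and j1: "\<And>a a'. a < Suc k \<Longrightarrow> a' < Suc k \<Longrightarrow> (\<Sum>x<Suc k. A a x * A x a') + (\<Sum>b\<in>verts H. R a b * R a' b)
          + u a * u a' = (if a = a' then 1 else 0)"
    and j2: "\<And>b b'. b \<in> verts H \<Longrightarrow> b' \<in> verts H \<Longrightarrow> (\<Sum>y\<in>verts H. C b y * C y b') + (\<Sum>a<Suc k. R a b * R a b')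
          + v b * v b' = (if b = b' then 1 else 0)"
    and j3: "\<And>a b. a < Suc k \<Longrightarrow> b \<in> verts H \<Longrightarrow> (\<Sum>x<Suc k. A a x * R x b) + (\<Sum>y\<in>verts H. R a y * C y b) = 0"
    and j4: "\<And>a. a < Suc k \<Longrightarrow> (\<Sum>x<Suc k. A a x * u x) = 0"
    and j5: "\<And>b. b \<in> verts H \<Longrightarrow> (\<Sum>y\<in>verts H. C b y * v y) = 0"
    and j6: "\<And>a. a < Suc k \<Longrightarrow> (\<Sum>b\<in>verts H. R a b * v b) = 0"
    and j7: "\<And>b. b \<in> verts H \<Longrightarrow> (\<Sum>a<Suc k. R a b * u a) = 0"
    and j8: "(\<Sum>a<Suc k. u a * u a) = 1" "(\<Sum>b\<in>verts H. v b * v b) = 1"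
    and j9: "\<And>a. a < Suc k \<Longrightarrow> u a \<noteq> 0" "\<And>b. b \<in> verts H \<Longrightarrow> v b \<noteq> 0"
    and j10: "\<And>a b. a < Suc k \<Longrightarrow> b \<in> verts H \<Longrightarrow> w * (u a * v b) + R a b \<noteq> 0"
    using J unfolding join_data_def vK lessThan_iff Ball_def by simp_all
  \<comment> \<open>\<open>p\<close> merges the copies \<open>k\<close> and \<open>Suc k\<close>,
    and \<open>s\<close> holds the weights of S; \<open>clone\<close> below is S^T S = 1.\<close>
  define p where "p x = min x k" for x :: nat
  define s where "s x = (if x < k then 1 else 1 / sqrt 2 :: real)" for x :: nat
  have p: "p x < Suc k" for x by (simp add: p_def)
  have s: "s x > 0" for x by (simp add: s_def)
  have clone: "(\<Sum>x<Suc (Suc k). s x * s x * f (p x)) = (\<Sum>x<Suc k. f x)" for f :: "nat \<Rightarrow> real"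
  proof -
    have "(\<Sum>x<k. s x * s x * f (p x)) = (\<Sum>x<k. f x)"
      by (intro sum.cong refl) (auto simp: s_def p_def)
    thus ?thesis by (simp add: s_def p_def sum.lessThan_Suc)
  qed
  define N where "N x y = (if x = y then 1 else 0) - A x y" for x y
  define A' where "A' x y = (if x < Suc (Suc k) \<and> y < Suc (Suc k)
      then (if x = y then 1 else 0) - s x * s y * N (p x) (p y) else 0)" for x y
  define R' where "R' x b = s x * R (p x) b" for x b
  define u' where "u' x = s x * u (p x)" for x
  have Nsym: "N x y = N y x" for x y by (simp add: N_def S_graph_sym[OF A, of x y])
  \<comment> \<open>The two copies have to be adjacent, and their entry in \<open>A'\<close> is
    \<open>- N k k / 2\<close>. It is nonzero because \<open>u k \<noteq> 0\<close> forces
    \<open>A k k < 1\<close> in the row identity.\<close>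
  have Akk: "N k k \<noteq> 0"
  proof -
    have "A k k * A k k \<le> (\<Sum>x<Suc k. A k x * A x k)"
      by (rule member_le_sum) (simp_all add: S_graph_sym[OF A, of k])
    moreover have "u k * u k > 0" using j9(1)[of k] by (auto simp: zero_less_mult_iff linorder_neq_iff)
    moreover have "(\<Sum>b\<in>verts H. R k b * R k b) \<ge> 0" by (intro sum_nonneg) simp
    ultimately have "A k k * A k k < 1" using j1[of k k] by simp
    thus ?thesis by (auto simp: N_def)
  qed
  have A': "A' \<in> S_graph ?L"
    unfolding S_graph_def vL
  proof (intro CollectI conjI allI ballI impI)
    fix i j show "A' i j = A' j i" by (simp add: A'_def Nsym[of "p i"] mult.commute)
  next
    fix i j assume ij: "i \<in> {..<Suc (Suc k)}" "j \<in> {..<Suc (Suc k)}" "i \<noteq> j"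
    have "N (p i) (p j) \<noteq> 0"
    proof (cases "p i = p j")
      case True
      hence "p i = k" "p j = k" using ij by (auto simp: p_def min_def split: if_splits)
      thus ?thesis using Akk by simp
    next
      case False
      have "A (p i) (p j) \<noteq> 0"
        using A False p[of i] p[of j] unfolding S_graph_def vK
        by (simp add: adj_def complete_graph_def)
      thus ?thesis using False by (simp add: N_def)
    qed
    hence "A' i j \<noteq> 0" using ij s[of i] s[of j] by (simp add: A'_def)
    thus "(A' i j \<noteq> 0) = adj ?L i j" using ij by (simp add: adj_def complete_graph_def)
  qed (auto simp: A'_def)
  have A'mult: "(\<Sum>x<Suc (Suc k). A' a x * (s x * f (p x))) = s a * (\<Sum>x<Suc k. A (p a) x * f x)"
    if a: "a < Suc (Suc k)" for a f
  proof -
    have "(\<Sum>x<Suc (Suc k). A' a x * (s x * f (p x)))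
        = (\<Sum>x<Suc (Suc k). (if x = a then s a * f (p a) else 0) - s a * (s x * s x * (N (p a) (p x) * f (p x))))"
      using a by (intro sum.cong refl) (auto simp: A'_def algebra_simps)
    also have "\<dots> = s a * f (p a) - s a * (\<Sum>x<Suc k. N (p a) x * f x)"
      using a clone[of "\<lambda>x. N (p a) x * f x"]
      by (simp only: sum_subtractf sum_distrib_left[symmetric]) simp
    also have "(\<Sum>x<Suc k. N (p a) x * f x) = (\<Sum>x<Suc k. (if x = p a then f (p a) else 0) - A (p a) x * f x)"
      by (intro sum.cong refl) (auto simp: N_def algebra_simps)
    also have "\<dots> = f (p a) - (\<Sum>x<Suc k. A (p a) x * f x)"
      using p[of a] by (simp only: sum_subtractf) simp
    finally show ?thesis by (simp add: right_diff_distrib)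
  qed
  have R'sq: "(\<Sum>x<Suc (Suc k). (s x * f (p x)) * (s x * g (p x))) = (\<Sum>x<Suc k. f x * g x)" for f g
    using clone[of "\<lambda>x. f x * g x"] by (simp only: mult_ac)
  have 1: "(\<Sum>x<Suc (Suc k). A' a x * A' x a') + (\<Sum>b\<in>verts H. R' a b * R' a' b)
          + u' a * u' a' = (if a = a' then 1 else 0)" if a: "a < Suc (Suc k)" "a' < Suc (Suc k)" for a a'
  proof -
    have "(\<Sum>x<Suc (Suc k). A' a x * A' x a')
        = (\<Sum>x<Suc (Suc k). (if x = a' then A' a a' else 0) - A' a x * (s x * N (p x) (p a')) * s a')"
      using a by (intro sum.cong refl) (auto simp: A'_def algebra_simps)
    also have "\<dots> = A' a a' - s a * (\<Sum>x<Suc k. A (p a) x * N x (p a')) * s a'"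
      using a A'mult[OF a(1), of "\<lambda>x. N x (p a')"]
      by (simp only: sum_subtractf sum_distrib_right[symmetric]) simp
    also have "(\<Sum>x<Suc k. A (p a) x * N x (p a'))
        = (\<Sum>x<Suc k. (if x = p a' then A (p a) (p a') else 0) - A (p a) x * A x (p a'))"
      by (intro sum.cong refl) (auto simp: N_def algebra_simps)
    also have "\<dots> = A (p a) (p a') - (\<Sum>x<Suc k. A (p a) x * A x (p a'))"
      using p[of a'] by (simp only: sum_subtractf) simp
    finally have i: "(\<Sum>x<Suc (Suc k). A' a x * A' x a')
        = A' a a' - s a * (A (p a) (p a') - (\<Sum>x<Suc k. A (p a) x * A x (p a'))) * s a'" .
    have ii: "(\<Sum>b\<in>verts H. R' a b * R' a' b) = s a * s a' * (\<Sum>b\<in>verts H. R (p a) b * R (p a') b)"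
      unfolding sum_distrib_left by (intro sum.cong refl) (simp add: R'_def)
    have iii: "A' a a' = (if a = a' then 1 else 0) - s a * s a' * N (p a) (p a')"
      using a by (simp add: A'_def)
    have "(\<Sum>x<Suc (Suc k). A' a x * A' x a') + (\<Sum>b\<in>verts H. R' a b * R' a' b) + u' a * u' a'
       = (if a = a' then 1 else 0) + s a * s a' * (((\<Sum>x<Suc k. A (p a) x * A x (p a'))
           + (\<Sum>b\<in>verts H. R (p a) b * R (p a') b) + u (p a) * u (p a')) - (if p a = p a' then 1 else 0))"
      unfolding i ii iii u'_def N_def by (simp only: algebra_simps)
    also have "\<dots> = (if a = a' then 1 else 0)"
      unfolding j1[OF p p] by simp
    finally show ?thesis .
  qed
  have 2: "(\<Sum>y\<in>verts H. C b y * C y b') + (\<Sum>a<Suc (Suc k). R' a b * R' a b')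
          + v b * v b' = (if b = b' then 1 else 0)" if "b \<in> verts H" "b' \<in> verts H" for b b'
    using j2[OF that] R'sq[of "\<lambda>x. R x b" "\<lambda>x. R x b'"] unfolding R'_def by simp
  have 3: "(\<Sum>x<Suc (Suc k). A' a x * R' x b) + (\<Sum>y\<in>verts H. R' a y * C y b) = 0"
    if a: "a < Suc (Suc k)" and b: "b \<in> verts H" for a b
  proof -
    have "(\<Sum>y\<in>verts H. R' a y * C y b) = s a * (\<Sum>y\<in>verts H. R (p a) y * C y b)"
      unfolding sum_distrib_left R'_def by (simp only: mult.assoc)
    thus ?thesis using A'mult[OF a, of "\<lambda>x. R x b"] j3[OF p b, of a] unfolding R'_def
      by (simp only: distrib_left[symmetric] mult_zero_right)
  qed
  have 4: "(\<Sum>x<Suc (Suc k). A' a x * u' x) = 0" if a: "a < Suc (Suc k)" for a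
    unfolding u'_def A'mult[OF a] j4[OF p] by simp
  have 6: "(\<Sum>b\<in>verts H. R' a b * v b) = 0" for a
  proof -
    have "(\<Sum>b\<in>verts H. R' a b * v b) = s a * (\<Sum>b\<in>verts H. R (p a) b * v b)"
      unfolding sum_distrib_left R'_def by (simp only: mult.assoc)
    thus ?thesis unfolding j6[OF p] by simp
  qed
  have 7: "(\<Sum>a<Suc (Suc k). R' a b * u' a) = 0" if "b \<in> verts H" for b
    unfolding R'_def u'_def R'sq[of "\<lambda>x. R x b"] by (rule j7[OF that])
  have 8: "(\<Sum>a<Suc (Suc k). u' a * u' a) = 1"
    unfolding u'_def R'sq by (rule j8)
  have 9: "u' a \<noteq> 0" for a using j9(1)[OF p, of a] s[of a] by (simp add: u'_def)
  have 10: "w * (u' a * v b) + R' a b \<noteq> 0" if "b \<in> verts H" for a b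
  proof -
    have "w * (u' a * v b) + R' a b = s a * (w * (u (p a) * v b) + R (p a) b)"
      by (simp add: u'_def R'_def algebra_simps)
    thus ?thesis using j10[OF p that, of a] s[of a] by simp
  qed
  have "join_data w ?L H A' C R' u' v"
    unfolding join_data_def vL
    by (intro conjI ballI A' C 1 2 3 4 j5 6 7 8 j8(2) 9 j9(2) 10) simp_all
  thus ?thesis unfolding joinable_def by blast
qed

lemma connected_complete_graph:
  assumes "m \<ge> 1"
  shows "connected_graph (complete_graph m)"
proof -
  let ?K = "complete_graph m"
  have "(adj ?K)\<^sup>*\<^sup>* u v" if "u < m" "v < m" for u v
  proof (cases "u = v")
    case False
    hence "adj ?K u v" using that by (simp add: adj_def complete_graph_def)
    thus ?thesis by blast
  qed simp
  moreover have "0 < m" using assms by simp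
  ultimately show ?thesis
    unfolding connected_graph_def simple_graph_def
    by (auto simp: verts_def adj_def complete_graph_def)
qed

text \<open>Up to the size of \<open>H\<close> the result for arbitrary connected graphs applies;
  larger complete graphs arise by doubling vertices, starting from equal sizes.\<close>

lemma joinable_complete_graph:
  fixes H :: "'b graph"
  assumes H: "connected_graph H" and w: "w \<noteq> 0" and m: "m \<ge> 1" and le: "card (verts H) \<le> m + 2"
  shows "joinable w (complete_graph m) H"
proof -
  define h where "h = card (verts H)"
  have h: "h \<ge> 1"
    using H unfolding h_def connected_graph_def simple_graph_def by (simp add: Suc_le_eq card_gt_0_iff)
  have cK: "card (verts (complete_graph j)) = j" for j by (simp add: verts_def complete_graph_def)
  have small: "joinable w (complete_graph j) H" if "1 \<le> j" "j \<le> h" "h \<le> j + 2" for j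
    by (rule joinable_if_card_close[OF connected_complete_graph[OF that(1)] H w])
       (use that in \<open>simp_all add: cK h_def\<close>)
  show ?thesis
  proof (cases "m \<le> h")
    case True thus ?thesis using small m le by (simp add: h_def)
  next
    case False
    hence "h \<le> m" by simp
    thus ?thesis
    proof (induction m rule: dec_induct)
      case base show ?case using small h by simp
    next
      case (step j)
      then obtain i where "j = Suc i" using h by (cases j) auto
      thus ?case using joinable_complete_graph_Suc step.IH by blast
    qed
  qed
qed

text \<open>
  A Householder reflection. Reflecting along \<open>(1, \<dots>, 1)\<close> would give zero diagonal entries when
  \<open>k = 2\<close>, hence the longer first coordinate.
\<close>
lemma nowhere_zero_reflection:
  fixes k :: nat
  assumes "k \<ge> 1"
  shows "\<exists>W :: nat \<Rightarrow> nat \<Rightarrow> real. (\<forall>i j. W i j = W j i) \<and> (\<forall>i<k. \<forall>j<k. W i j \<noteq> 0)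
    \<and> (\<forall>i<k. \<forall>j<k. (\<Sum>l<k. W i l * W l j) = (if i = j then 1 else 0))"
proof -
  \<comment> \<open>The square norm is \<open>(k + 1) + (k - 1)\<close>, so the reflection is 1 - h
    h^T / k. Its diagonal entries are \<open>- 1 / k\<close> and, for \<open>k \<ge> 2\<close> only,
    \<open>1 - 1 / k\<close>.\<close>
  define h where "h i = (if i = 0 then sqrt (real k + 1) else 1)" for i :: nat
  define W where "W i j = (if i = j then 1 else 0) - h i * h j / real k" for i j
  have h: "h i > 0" for i by (simp add: h_def)
  have k0: "real k > 0" using assms by simp
  obtain k' where k': "k = Suc k'" using assms by (cases k) auto
  have hh: "(\<Sum>l<k. h l * h l) = 2 * real k"
    unfolding k' sum.lessThan_Suc_shift by (simp add: h_def k')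
  have "W i j \<noteq> 0" if "i < k" "j < k" for i j
  proof (cases "i = j")
    case True
    show ?thesis
    proof (cases "i = 0")
      case i0: True thus ?thesis using True k0 by (simp add: W_def h_def field_simps)
    next
      case False
      hence "real k \<noteq> 1" using that by auto
      thus ?thesis using True False k0 by (simp add: W_def h_def)
    qed
  next
    case False thus ?thesis using h[of i] h[of j] k0 by (simp add: W_def)
  qed
  moreover have "(\<Sum>l<k. W i l * W l j) = (if i = j then 1 else 0)" if "i < k" "j < k" for i j
  proof -
    have "(\<Sum>l<k. W i l * W l j) = (\<Sum>l<k. (if l = i then W i j else 0)
        - (if l = j then h i * h j / real k else 0) + (h l * h l) * (h i * h j / (real k * real k)))"
      by (intro sum.cong refl) (auto simp: W_def algebra_simps)
    also have "\<dots> = W i j - h i * h j / real k + 2 * real k * (h i * h j / (real k * real k))"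
      using that by (simp only: sum.distrib sum_subtractf sum_distrib_right[symmetric] hh) simp
    also have "\<dots> = (if i = j then 1 else 0)" using k0 by (simp add: W_def field_simps)
    finally show ?thesis .
  qed
  moreover have "W i j = W j i" for i j by (simp add: W_def mult.commute)
  ultimately show ?thesis by (intro exI[of _ W]) auto
qed

section \<open>Joins of disjoint unions\<close>

lemma verts_join_dunion:
  "verts (join (dunion k G) (dunion k H))
     = Inl ` Sigma {..<k} (\<lambda>i. verts (G i)) \<union> Inr ` Sigma {..<k} (\<lambda>i. verts (H i))"
  unfolding join_def dunion_def verts_def by auto

lemma sum_join_dunion:
  fixes f :: "(nat \<times> 'a) + (nat \<times> 'b) \<Rightarrow> real"
  assumes "\<And>i. i < k \<Longrightarrow> finite (verts (G i))" "\<And>i. i < k \<Longrightarrow> finite (verts (H i))"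
  shows "(\<Sum>x\<in>verts (join (dunion k G) (dunion k H)). f x)
     = (\<Sum>i<k. \<Sum>a\<in>verts (G i). f (Inl (i, a))) + (\<Sum>i<k. \<Sum>b\<in>verts (H i). f (Inr (i, b)))"
proof -
  have fin: "finite (Sigma {..<k} (\<lambda>i. verts (G i)))" "finite (Sigma {..<k} (\<lambda>i. verts (H i)))"
    using assms by (auto intro: finite_SigmaI)
  have "(\<Sum>x\<in>verts (join (dunion k G) (dunion k H)). f x)
      = (\<Sum>x\<in>Inl ` Sigma {..<k} (\<lambda>i. verts (G i)). f x) + (\<Sum>x\<in>Inr ` Sigma {..<k} (\<lambda>i. verts (H i)). f x)"
    unfolding verts_join_dunion by (rule sum.union_disjoint) (use fin in auto)
  also have "\<dots> = (\<Sum>x\<in>Sigma {..<k} (\<lambda>i. verts (G i)). f (Inl x)) + (\<Sum>x\<in>Sigma {..<k} (\<lambda>i. verts (H i)). f (Inr x))"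
    by (simp add: sum.reindex)
  also have "\<dots> = (\<Sum>i<k. \<Sum>a\<in>verts (G i). f (Inl (i, a))) + (\<Sum>i<k. \<Sum>b\<in>verts (H i). f (Inr (i, b)))"
    using assms by (simp add: sum.Sigma)
  finally show ?thesis .
qed

text \<open>The guard \<open>fst p < k\<close> produces the zeros that \<open>S_graph\<close>
  demands outside the vertex set, since \<open>A i\<close> is arbitrary for
  \<open>i \<ge> k\<close>.\<close>

definition diagonal_blocks :: "nat \<Rightarrow> (nat \<Rightarrow> 'a \<Rightarrow> 'a \<Rightarrow> real) \<Rightarrow> nat \<times> 'a \<Rightarrow> nat \<times> 'a \<Rightarrow> real" where
  "diagonal_blocks k A p q = (if fst p = fst q \<and> fst p < k then A (fst p) (snd p) (snd q) else 0)"

lemma diagonal_blocks_in_S_graph: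
  assumes "\<And>i. i < k \<Longrightarrow> A i \<in> S_graph (G i)"
  shows "diagonal_blocks k A \<in> S_graph (dunion k G)"
  using assms unfolding S_graph_def diagonal_blocks_def dunion_def verts_def adj_def
  by (auto split: if_splits)

lemma join_in_S_graph:
  assumes A: "A \<in> S_graph G" and C: "C \<in> S_graph H"
    and B: "\<And>a b. a \<in> verts G \<and> b \<in> verts H \<longleftrightarrow> B a b \<noteq> 0"
  shows "(\<lambda>p q. case p of Inl a \<Rightarrow> (case q of Inl a' \<Rightarrow> A a a' | Inr b \<Rightarrow> B a b)
            | Inr b \<Rightarrow> (case q of Inl a \<Rightarrow> B a b | Inr b' \<Rightarrow> C b b')) \<in> S_graph (join G H)"
proof -
  have vj: "verts (join G H) = Inl ` verts G \<union> Inr ` verts H" by (simp add: join_def verts_def)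
  have aj: "adj (join G H) (Inl a) (Inl a') = adj G a a'" "adj (join G H) (Inr b) (Inr b') = adj H b b'"
    "adj (join G H) (Inl a) (Inr b) \<longleftrightarrow> a \<in> verts G \<and> b \<in> verts H"
    "adj (join G H) (Inr b) (Inl a) \<longleftrightarrow> b \<in> verts H \<and> a \<in> verts G" for a a' b b'
    by (auto simp: join_def adj_def)
  have mem: "Inl a \<in> Inl ` X \<union> Inr ` Y \<longleftrightarrow> a \<in> X" "Inr b \<in> Inl ` X \<union> Inr ` Y \<longleftrightarrow> b \<in> Y"
    for a b and X :: "'c set" and Y :: "'d set" by auto
  have B0: "B a b = 0" if "a \<notin> verts G \<or> b \<notin> verts H" for a b using B that by blast
  have A0: "A a a' = 0" if "a \<notin> verts G \<or> a' \<notin> verts G" for a a'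
    using A that unfolding S_graph_def by blast
  have C0: "C a a' = 0" if "a \<notin> verts H \<or> a' \<notin> verts H" for a a'
    using C that unfolding S_graph_def by blast
  have A1: "A a a' \<noteq> 0 \<longleftrightarrow> adj G a a'" if "a \<in> verts G" "a' \<in> verts G" "a \<noteq> a'" for a a'
    using A that unfolding S_graph_def by blast
  have C1: "C a a' \<noteq> 0 \<longleftrightarrow> adj H a a'" if "a \<in> verts H" "a' \<in> verts H" "a \<noteq> a'" for a a'
    using C that unfolding S_graph_def by blast
  show ?thesis
    unfolding S_graph_def vj
  proof (intro CollectI conjI allI ballI impI, goal_cases)
    case (1 i j)
    thus ?case by (cases i; cases j) (simp_all only: mem sum.case, (blast intro: A0 B0 C0)+)
  next
    case (2 i j)
    show ?case by (cases i; cases j) (simp_all, (rule S_graph_sym[OF A] S_graph_sym[OF C])+)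
  next
    case (3 i j)
    thus ?case using B by (cases i; cases j) (simp_all only: mem sum.case sum.inject A1 C1 aj, blast+)
  qed
qed

text \<open>\<open>J\<close> ranges over all nonzero \<open>w\<close> because the scalars
  \<open>W i i\<close> are only fixed inside the proof, and they differ between components.\<close>

lemma q_graph_join_dunion_eq_2:
  fixes G :: "nat \<Rightarrow> 'a graph" and H :: "nat \<Rightarrow> 'b graph"
  assumes k: "k \<ge> 1"
    and G: "\<And>i. i < k \<Longrightarrow> connected_graph (G i)" and H: "\<And>i. i < k \<Longrightarrow> connected_graph (H i)"
    and J: "\<And>i w. i < k \<Longrightarrow> w \<noteq> 0 \<Longrightarrow> joinable w (G i) (H i)"
  shows "q_graph (join (dunion k G) (dunion k H)) = 2"
proof -
  let ?\<Gamma> = "join (dunion k G) (dunion k H)"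
  have finG: "finite (verts (G i))" and neG: "verts (G i) \<noteq> {}" if "i < k" for i
    using G[OF that] unfolding connected_graph_def simple_graph_def by blast+
  have finH: "finite (verts (H i))" and neH: "verts (H i) \<noteq> {}" if "i < k" for i
    using H[OF that] unfolding connected_graph_def simple_graph_def by blast+
  have fin: "finite (verts ?\<Gamma>)"
    unfolding verts_join_dunion using finG finH by (auto intro!: finite_SigmaI)
  obtain a0 b0 where ab0: "a0 \<in> verts (G 0)" "b0 \<in> verts (H 0)" using neG[of 0] neH[of 0] k by fastforce
  \<comment> \<open>A join edge, hence a nonzero off-diagonal entry of every matrix in the class: it
    rules out scalar matrices for both bounds.\<close>
  define p q where "p = (Inl (0, a0) :: (nat \<times> 'a) + (nat \<times> 'b))" and "q = (Inr (0, b0) :: (nat \<times> 'a) + (nat \<times> 'b))"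
  have pq: "p \<in> verts ?\<Gamma>" "q \<in> verts ?\<Gamma>" "p \<noteq> q"
    using ab0 k by (auto simp: p_def q_def verts_join_dunion)
  have adjpq: "adj ?\<Gamma> p q" using ab0 k by (simp add: p_def q_def join_def dunion_def adj_def verts_def)
  have Mpq: "M p q \<noteq> 0" if "M \<in> S_graph ?\<Gamma>" for M
    using that pq adjpq unfolding S_graph_def by blast
  have lower: "2 \<le> q_mat (verts ?\<Gamma>) M" if "M \<in> S_graph ?\<Gamma>" for M
    by (rule q_mat_ge_2[OF fin S_graph_sym[OF that] pq Mpq[OF that]])
  obtain W :: "nat \<Rightarrow> nat \<Rightarrow> real" where Wsym: "\<And>i j. W i j = W j i"
    and Wnz: "\<And>i j. i < k \<Longrightarrow> j < k \<Longrightarrow> W i j \<noteq> 0"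
    and WW: "\<And>i j. i < k \<Longrightarrow> j < k \<Longrightarrow> (\<Sum>l<k. W i l * W l j) = (if i = j then 1 else 0)"
    using nowhere_zero_reflection[OF k] by metis
  have "\<forall>i. i < k \<longrightarrow> (\<exists>A C R u v. join_data (W i i) (G i) (H i) A C R u v)"
    using J Wnz unfolding joinable_def by blast
  then obtain A C R u v where JD: "\<And>i. i < k \<Longrightarrow> join_data (W i i) (G i) (H i) (A i) (C i) (R i) (u i) (v i)"
    by metis
  have AS: "A i \<in> S_graph (G i)" and CS: "C i \<in> S_graph (H i)"
    and j1: "\<And>a a'. a \<in> verts (G i) \<Longrightarrow> a' \<in> verts (G i) \<Longrightarrow> (\<Sum>x\<in>verts (G i). A i a x * A i x a')
        + (\<Sum>b\<in>verts (H i). R i a b * R i a' b) + u i a * u i a' = (if a = a' then 1 else 0)"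
    and j2: "\<And>b b'. b \<in> verts (H i) \<Longrightarrow> b' \<in> verts (H i) \<Longrightarrow> (\<Sum>y\<in>verts (H i). C i b y * C i y b')
        + (\<Sum>a\<in>verts (G i). R i a b * R i a b') + v i b * v i b' = (if b = b' then 1 else 0)"
    and j3: "\<And>a b. a \<in> verts (G i) \<Longrightarrow> b \<in> verts (H i) \<Longrightarrow>
        (\<Sum>x\<in>verts (G i). A i a x * R i x b) + (\<Sum>y\<in>verts (H i). R i a y * C i y b) = 0"
    and j4: "\<And>a. a \<in> verts (G i) \<Longrightarrow> (\<Sum>x\<in>verts (G i). A i a x * u i x) = 0"
    and j5: "\<And>b. b \<in> verts (H i) \<Longrightarrow> (\<Sum>y\<in>verts (H i). C i b y * v i y) = 0"
    and j6: "\<And>a. a \<in> verts (G i) \<Longrightarrow> (\<Sum>b\<in>verts (H i). R i a b * v i b) = 0"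
    and j7: "\<And>b. b \<in> verts (H i) \<Longrightarrow> (\<Sum>a\<in>verts (G i). R i a b * u i a) = 0"
    and j8: "(\<Sum>a\<in>verts (G i). u i a * u i a) = 1" and j8': "(\<Sum>b\<in>verts (H i). v i b * v i b) = 1"
    and j9: "\<And>a. a \<in> verts (G i) \<Longrightarrow> u i a \<noteq> 0" and j9': "\<And>b. b \<in> verts (H i) \<Longrightarrow> v i b \<noteq> 0"
    and j10: "\<And>a b. a \<in> verts (G i) \<Longrightarrow> b \<in> verts (H i) \<Longrightarrow> W i i * (u i a * v i b) + R i a b \<noteq> 0"
    if "i < k" for i
    using JD[OF that] unfolding join_data_def by simp_all
  \<comment> \<open>The kernel vectors couple every pair of components through \<open>W\<close>;
    \<open>R\<close> acts only within a component.\<close>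
  define B where "B p q = (if fst p < k \<and> fst q < k \<and> snd p \<in> verts (G (fst p)) \<and> snd q \<in> verts (H (fst q))
      then W (fst p) (fst q) * (u (fst p) (snd p) * v (fst q) (snd q))
         + (if fst p = fst q then R (fst p) (snd p) (snd q) else 0) else 0)" for p :: "nat \<times> 'a" and q :: "nat \<times> 'b"
  have Bin: "B (i, a) (j, b) = W i j * (u i a * v j b) + (if i = j then R i a b else 0)"
    if "i < k" "j < k" "a \<in> verts (G i)" "b \<in> verts (H j)" for i j a b
    using that by (simp add: B_def)
  define M where "M = (\<lambda>p q. case p of
      Inl a \<Rightarrow> (case q of Inl a' \<Rightarrow> diagonal_blocks k A a a' | Inr b \<Rightarrow> B a b)
    | Inr b \<Rightarrow> (case q of Inl a \<Rightarrow> B a b | Inr b' \<Rightarrow> diagonal_blocks k C b b'))"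
  have M: "M \<in> S_graph ?\<Gamma>"
    unfolding M_def
  proof (rule join_in_S_graph)
    show "diagonal_blocks k A \<in> S_graph (dunion k G)" by (rule diagonal_blocks_in_S_graph[OF AS])
    show "diagonal_blocks k C \<in> S_graph (dunion k H)" by (rule diagonal_blocks_in_S_graph[OF CS])
    fix x :: "nat \<times> 'a" and y :: "nat \<times> 'b"
    obtain i a j b where xy: "x = (i, a)" "y = (j, b)" by (cases x, cases y)
    have "B (i, a) (j, b) \<noteq> 0" if ij: "i < k" "j < k" "a \<in> verts (G i)" "b \<in> verts (H j)"
      using Bin[OF ij] j10[OF ij(1,3)] Wnz[OF ij(1,2)] j9[OF ij(1,3)] j9'[OF ij(2,4)] ij
      by (cases "i = j") simp_all
    moreover have "B (i, a) (j, b) = 0" if "\<not> (i < k \<and> j < k \<and> a \<in> verts (G i) \<and> b \<in> verts (H j))"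
      using that unfolding B_def fst_conv snd_conv by (rule if_not_P)
    moreover have "x \<in> verts (dunion k G) \<and> y \<in> verts (dunion k H)
        \<longleftrightarrow> i < k \<and> j < k \<and> a \<in> verts (G i) \<and> b \<in> verts (H j)"
      unfolding xy dunion_def verts_def by auto
    ultimately show "x \<in> verts (dunion k G) \<and> y \<in> verts (dunion k H) \<longleftrightarrow> B x y \<noteq> 0"
      unfolding xy by metis
  qed
  have sumM: "(\<Sum>x\<in>verts ?\<Gamma>. f x)
     = (\<Sum>i<k. \<Sum>a\<in>verts (G i). f (Inl (i, a))) + (\<Sum>i<k. \<Sum>b\<in>verts (H i). f (Inr (i, b)))" for f :: "_ \<Rightarrow> real"
    by (rule sum_join_dunion) (use finG finH in auto)
  have ifsum: "(\<Sum>x\<in>S. if P then f x else 0) = (if P then \<Sum>x\<in>S. f x else 0)" for P and f :: "'c \<Rightarrow> real" and S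
    by simp
  have MB: "M (Inl (i, a)) (Inr (j, b)) = W i j * (u i a * v j b) + (if i = j then R i a b else 0)"
    "M (Inr (j, b)) (Inl (i, a)) = W i j * (u i a * v j b) + (if i = j then R i a b else 0)"
    if "i < k" "j < k" "a \<in> verts (G i)" "b \<in> verts (H j)" for i j a b
    using Bin[OF that] by (simp_all add: M_def)
  \<comment> \<open>Two entries of the off-diagonal block multiply to a kernel term, two mixed terms
    and an \<open>R\<close> term. After summation the mixed terms vanish, as \<open>R\<close>
    annihilates \<open>v\<close> and its transpose annihilates \<open>u\<close>.\<close>
  have block_product: "(W1 * (p1 * s) + (if i = l then r1 else 0)) * (W2 * (p2 * s) + (if j = l then r2 else 0))
      = W1 * W2 * (p1 * p2) * (s * s) + (if l = j then W1 * p1 * (r2 * s) else 0)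
        + (if l = i then W2 * p2 * (r1 * s) else 0) + (if l = i \<and> l = j then r1 * r2 else 0)"
    for W1 W2 p1 p2 r1 r2 s :: real and i j l :: nat
    by (simp add: algebra_simps)
  have ll: "(\<Sum>x\<in>verts ?\<Gamma>. M (Inl (i, a)) x * M x (Inl (j, a'))) = (if (i, a) = (j, a') then 1 else 0)"
    if ij: "i < k" "j < k" "a \<in> verts (G i)" "a' \<in> verts (G j)" for i j a a'
  proof -
    have "(\<Sum>l<k. \<Sum>x\<in>verts (G l). M (Inl (i, a)) (Inl (l, x)) * M (Inl (l, x)) (Inl (j, a')))
        = (\<Sum>l<k. if l = i then (if i = j then \<Sum>x\<in>verts (G i). A i a x * A i x a' else 0) else 0)"
      by (intro sum.cong refl) (auto simp: M_def diagonal_blocks_def)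
    hence 1: "(\<Sum>l<k. \<Sum>x\<in>verts (G l). M (Inl (i, a)) (Inl (l, x)) * M (Inl (l, x)) (Inl (j, a')))
        = (if i = j then \<Sum>x\<in>verts (G i). A i a x * A i x a' else 0)" using ij by simp
    have "(\<Sum>y\<in>verts (H l). M (Inl (i, a)) (Inr (l, y)) * M (Inr (l, y)) (Inl (j, a')))
        = W i l * W l j * (u i a * u j a')
          + (if l = i then (if i = j then \<Sum>y\<in>verts (H i). R i a y * R i a' y else 0) else 0)" if l: "l < k" for l
    proof -
      have "(\<Sum>y\<in>verts (H l). M (Inl (i, a)) (Inr (l, y)) * M (Inr (l, y)) (Inl (j, a')))
        = (\<Sum>y\<in>verts (H l). W i l * W l j * (u i a * u j a') * (v l y * v l y)
            + (if l = j then W i l * u i a * (R j a' y * v l y) else 0)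
            + (if l = i then W l j * u j a' * (R i a y * v l y) else 0)
            + (if l = i \<and> l = j then R i a y * R i a' y else 0))"
      proof (intro sum.cong refl)
        fix y assume y: "y \<in> verts (H l)"
        show "M (Inl (i, a)) (Inr (l, y)) * M (Inr (l, y)) (Inl (j, a'))
          = W i l * W l j * (u i a * u j a') * (v l y * v l y)
            + (if l = j then W i l * u i a * (R j a' y * v l y) else 0)
            + (if l = i then W l j * u j a' * (R i a y * v l y) else 0)
            + (if l = i \<and> l = j then R i a y * R i a' y else 0)"
          unfolding MB(1)[OF ij(1) l ij(3) y] MB(2)[OF ij(2) l ij(4) y] Wsym[of l j] block_product
          by (cases "l = i \<and> l = j") auto
      qed
      also have "\<dots> = W i l * W l j * (u i a * u j a') * (\<Sum>y\<in>verts (H l). v l y * v l y)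
            + (if l = j then W i l * u i a * (\<Sum>y\<in>verts (H l). R j a' y * v l y) else 0)
            + (if l = i then W l j * u j a' * (\<Sum>y\<in>verts (H l). R i a y * v l y) else 0)
            + (if l = i \<and> l = j then \<Sum>y\<in>verts (H l). R i a y * R i a' y else 0)"
        by (simp only: sum.distrib ifsum sum_distrib_left)
      also have "\<dots> = W i l * W l j * (u i a * u j a')
          + (if l = i then (if i = j then \<Sum>y\<in>verts (H i). R i a y * R i a' y else 0) else 0)"
        using j8'[OF l] j6[OF ij(1,3)] j6[OF ij(2,4)] by auto
      finally show ?thesis .
    qed
    hence "(\<Sum>l<k. \<Sum>y\<in>verts (H l). M (Inl (i, a)) (Inr (l, y)) * M (Inr (l, y)) (Inl (j, a')))
        = (\<Sum>l<k. W i l * W l j * (u i a * u j a')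
          + (if l = i then (if i = j then \<Sum>y\<in>verts (H i). R i a y * R i a' y else 0) else 0))"
      by (intro sum.cong refl) simp
    \<comment> \<open>Orthogonality of \<open>W\<close> reduces the kernel terms to
      \<open>u i a * u i a'\<close> for \<open>i = j\<close>, the last summand in the square
      identity \<open>j1\<close>.\<close>
    also have "\<dots> = (if i = j then 1 else 0) * (u i a * u j a')
          + (if i = j then \<Sum>y\<in>verts (H i). R i a y * R i a' y else 0)"
      using ij by (simp only: sum.distrib sum_distrib_right[symmetric] WW) simp
    finally show ?thesis
      unfolding sumM 1 using j1[OF ij(1,3), of a'] ij by (cases "i = j") auto
  qed
  have rr: "(\<Sum>x\<in>verts ?\<Gamma>. M (Inr (i, b)) x * M x (Inr (j, b'))) = (if (i, b) = (j, b') then 1 else 0)"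
    if ij: "i < k" "j < k" "b \<in> verts (H i)" "b' \<in> verts (H j)" for i j b b'
  proof -
    have "(\<Sum>l<k. \<Sum>y\<in>verts (H l). M (Inr (i, b)) (Inr (l, y)) * M (Inr (l, y)) (Inr (j, b')))
        = (\<Sum>l<k. if l = i then (if i = j then \<Sum>y\<in>verts (H i). C i b y * C i y b' else 0) else 0)"
      by (intro sum.cong refl) (auto simp: M_def diagonal_blocks_def)
    hence 1: "(\<Sum>l<k. \<Sum>y\<in>verts (H l). M (Inr (i, b)) (Inr (l, y)) * M (Inr (l, y)) (Inr (j, b')))
        = (if i = j then \<Sum>y\<in>verts (H i). C i b y * C i y b' else 0)" using ij by simp
    have "(\<Sum>x\<in>verts (G l). M (Inr (i, b)) (Inl (l, x)) * M (Inl (l, x)) (Inr (j, b')))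
        = W i l * W l j * (v i b * v j b')
          + (if l = i then (if i = j then \<Sum>x\<in>verts (G i). R i x b * R i x b' else 0) else 0)" if l: "l < k" for l
    proof -
      have "(\<Sum>x\<in>verts (G l). M (Inr (i, b)) (Inl (l, x)) * M (Inl (l, x)) (Inr (j, b')))
        = (\<Sum>x\<in>verts (G l). W i l * W l j * (v i b * v j b') * (u l x * u l x)
            + (if l = j then W i l * v i b * (R j x b' * u l x) else 0)
            + (if l = i then W l j * v j b' * (R i x b * u l x) else 0)
            + (if l = i \<and> l = j then R i x b * R i x b' else 0))"
      proof (intro sum.cong refl)
        fix x assume x: "x \<in> verts (G l)"
        show "M (Inr (i, b)) (Inl (l, x)) * M (Inl (l, x)) (Inr (j, b'))
          = W i l * W l j * (v i b * v j b') * (u l x * u l x)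
            + (if l = j then W i l * v i b * (R j x b' * u l x) else 0)
            + (if l = i then W l j * v j b' * (R i x b * u l x) else 0)
            + (if l = i \<and> l = j then R i x b * R i x b' else 0)"
        proof -
          have "M (Inr (i, b)) (Inl (l, x)) = W i l * (v i b * u l x) + (if i = l then R i x b else 0)"
            unfolding MB(2)[OF l ij(1) x ij(3)] Wsym[of i l] by (cases "i = l") auto
          moreover have "M (Inl (l, x)) (Inr (j, b')) = W l j * (v j b' * u l x) + (if j = l then R j x b' else 0)"
            unfolding MB(1)[OF l ij(2) x ij(4)] by (cases "j = l") auto
          moreover have "(if l = i \<and> l = j then R i x b * R j x b' else 0)
              = (if l = i \<and> l = j then R i x b * R i x b' else 0)" by auto
          ultimately show ?thesis by (simp only: block_product)
        qed
      qed
      also have "\<dots> = W i l * W l j * (v i b * v j b') * (\<Sum>x\<in>verts (G l). u l x * u l x)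
            + (if l = j then W i l * v i b * (\<Sum>x\<in>verts (G l). R j x b' * u l x) else 0)
            + (if l = i then W l j * v j b' * (\<Sum>x\<in>verts (G l). R i x b * u l x) else 0)
            + (if l = i \<and> l = j then \<Sum>x\<in>verts (G l). R i x b * R i x b' else 0)"
        by (simp only: sum.distrib ifsum sum_distrib_left)
      also have "\<dots> = W i l * W l j * (v i b * v j b')
          + (if l = i then (if i = j then \<Sum>x\<in>verts (G i). R i x b * R i x b' else 0) else 0)"
        using j8[OF l] j7[OF ij(1,3)] j7[OF ij(2,4)] by auto
      finally show ?thesis .
    qed
    hence "(\<Sum>l<k. \<Sum>x\<in>verts (G l). M (Inr (i, b)) (Inl (l, x)) * M (Inl (l, x)) (Inr (j, b')))
        = (\<Sum>l<k. W i l * W l j * (v i b * v j b')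
          + (if l = i then (if i = j then \<Sum>x\<in>verts (G i). R i x b * R i x b' else 0) else 0))"
      by (intro sum.cong refl) simp
    also have "\<dots> = (if i = j then 1 else 0) * (v i b * v j b')
          + (if i = j then \<Sum>x\<in>verts (G i). R i x b * R i x b' else 0)"
      using ij by (simp only: sum.distrib sum_distrib_right[symmetric] WW) simp
    finally show ?thesis
      unfolding sumM 1 using j2[OF ij(1,3), of b'] ij by (cases "i = j") auto
  qed
  \<comment> \<open>The kernel part drops out because A u = 0 and C v = 0, so \<open>W\<close> does
    not enter; within one component \<open>j3\<close> remains.\<close>
  have lr: "(\<Sum>x\<in>verts ?\<Gamma>. M (Inl (i, a)) x * M x (Inr (j, b))) = 0"
    if ij: "i < k" "j < k" "a \<in> verts (G i)" "b \<in> verts (H j)" for i j a b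
  proof -
    have "(\<Sum>l<k. \<Sum>x\<in>verts (G l). M (Inl (i, a)) (Inl (l, x)) * M (Inl (l, x)) (Inr (j, b)))
        = (\<Sum>l<k. if l = i then \<Sum>x\<in>verts (G i). A i a x * B (i, x) (j, b) else 0)"
      by (intro sum.cong refl) (auto simp: M_def diagonal_blocks_def)
    also have "\<dots> = (\<Sum>x\<in>verts (G i). W i j * v j b * (A i a x * u i x) + (if i = j then A i a x * R i x b else 0))"
      using ij by (simp, intro sum.cong refl) (auto simp: Bin algebra_simps)
    also have "\<dots> = W i j * v j b * (\<Sum>x\<in>verts (G i). A i a x * u i x)
        + (if i = j then \<Sum>x\<in>verts (G i). A i a x * R i x b else 0)"
      by (simp only: sum.distrib ifsum sum_distrib_left)
    finally have 1: "(\<Sum>l<k. \<Sum>x\<in>verts (G l). M (Inl (i, a)) (Inl (l, x)) * M (Inl (l, x)) (Inr (j, b)))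
        = (if i = j then \<Sum>x\<in>verts (G i). A i a x * R i x b else 0)" using j4[OF ij(1,3)] by simp
    have Csym: "C j y b = C j b y" for y by (rule S_graph_sym[OF CS[OF ij(2)]])
    have "(\<Sum>l<k. \<Sum>y\<in>verts (H l). M (Inl (i, a)) (Inr (l, y)) * M (Inr (l, y)) (Inr (j, b)))
        = (\<Sum>l<k. if l = j then \<Sum>y\<in>verts (H j). B (i, a) (j, y) * C j y b else 0)"
      by (intro sum.cong refl) (auto simp: M_def diagonal_blocks_def)
    also have "\<dots> = (\<Sum>y\<in>verts (H j). W i j * u i a * (C j b y * v j y) + (if i = j then R i a y * C j y b else 0))"
      using ij by (simp, intro sum.cong refl) (auto simp: Bin Csym algebra_simps)
    also have "\<dots> = W i j * u i a * (\<Sum>y\<in>verts (H j). C j b y * v j y)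
        + (if i = j then \<Sum>y\<in>verts (H j). R i a y * C j y b else 0)"
      by (simp only: sum.distrib ifsum sum_distrib_left)
    finally have 2: "(\<Sum>l<k. \<Sum>y\<in>verts (H l). M (Inl (i, a)) (Inr (l, y)) * M (Inr (l, y)) (Inr (j, b)))
        = (if i = j then \<Sum>y\<in>verts (H j). R i a y * C j y b else 0)" using j5[OF ij(2,4)] by simp
    show ?thesis unfolding sumM 1 2 using j3[OF ij(1,3), of b] ij by (cases "i = j") auto
  qed
  have rl: "(\<Sum>x\<in>verts ?\<Gamma>. M (Inr (j, b)) x * M x (Inl (i, a))) = 0"
    if ij: "i < k" "j < k" "a \<in> verts (G i)" "b \<in> verts (H j)" for i j a b
  proof -
    have "(\<Sum>x\<in>verts ?\<Gamma>. M (Inr (j, b)) x * M x (Inl (i, a))) = (\<Sum>x\<in>verts ?\<Gamma>. M (Inl (i, a)) x * M x (Inr (j, b)))"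
      by (intro sum.cong refl) (simp add: S_graph_sym[OF M, of "Inr (j, b)"] S_graph_sym[OF M, of _ "Inl (i, a)"])
    thus ?thesis using lr[OF ij] by simp
  qed
  have sq: "(\<Sum>l\<in>verts ?\<Gamma>. M x l * M l y) = (if x = y then 1 else 0)"
    if xy: "x \<in> verts ?\<Gamma>" "y \<in> verts ?\<Gamma>" for x y
  proof -
    have c: "(\<exists>i a. z = Inl (i, a) \<and> i < k \<and> a \<in> verts (G i)) \<or> (\<exists>i b. z = Inr (i, b) \<and> i < k \<and> b \<in> verts (H i))"
      if "z \<in> verts ?\<Gamma>" for z using that unfolding verts_join_dunion by auto
    show ?thesis using c[OF xy(1)] c[OF xy(2)] by (elim disjE exE conjE) (simp_all add: ll rr lr rl)
  qed
  have "q_mat (verts ?\<Gamma>) M = 2"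
    by (rule q_mat_involution[OF fin sq pq Mpq[OF M]])
  thus ?thesis
    unfolding q_graph_def using M lower by (intro Least_equality) auto
qed

theorem theorem3p4:
  fixes k :: nat
  assumes "k \<ge> 1"
  shows "(\<forall>(G :: nat \<Rightarrow> 'a graph) (H :: nat \<Rightarrow> 'b graph).
            (\<forall>i<k. connected_graph (G i) \<and> connected_graph (H i)
               \<and> \<bar>int (card (verts (G i))) - int (card (verts (H i)))\<bar> \<le> 2)
            \<longrightarrow> q_graph (join (dunion k G) (dunion k H)) = 2)
       \<and> (\<forall>(m :: nat \<Rightarrow> nat) (H :: nat \<Rightarrow> 'c graph).
            (\<forall>i<k. m i \<ge> 1 \<and> connected_graph (H i) \<and> m i + 2 \<ge> card (verts (H i)))
            \<longrightarrow> q_graph (join (dunion k (\<lambda>i. complete_graph (m i))) (dunion k H)) = 2)"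
proof (intro conjI allI impI)
  fix G :: "nat \<Rightarrow> 'a graph" and H :: "nat \<Rightarrow> 'b graph"
  assume h: "\<forall>i<k. connected_graph (G i) \<and> connected_graph (H i)
               \<and> \<bar>int (card (verts (G i))) - int (card (verts (H i)))\<bar> \<le> 2"
  show "q_graph (join (dunion k G) (dunion k H)) = 2"
  proof (rule q_graph_join_dunion_eq_2[OF assms])
    fix i w assume i: "i < k" "(w::real) \<noteq> 0"
    have "\<bar>int (card (verts (G i))) - int (card (verts (H i)))\<bar> \<le> 2" using h i by blast
    hence "card (verts (G i)) \<le> card (verts (H i)) + 2" "card (verts (H i)) \<le> card (verts (G i)) + 2"
      by linarith+
    thus "joinable w (G i) (H i)" using h i by (intro joinable_if_card_close) auto
  qed (use h in auto)
next
  fix m :: "nat \<Rightarrow> nat" and H :: "nat \<Rightarrow> 'c graph"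
  assume h: "\<forall>i<k. m i \<ge> 1 \<and> connected_graph (H i) \<and> m i + 2 \<ge> card (verts (H i))"
  show "q_graph (join (dunion k (\<lambda>i. complete_graph (m i))) (dunion k H)) = 2"
    by (rule q_graph_join_dunion_eq_2[OF assms])
       (use h in \<open>auto intro: connected_complete_graph joinable_complete_graph\<close>)
qed

end
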